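(* (i) For every fixed positive integer $r$, the number of induced $\vee_r$-free families $\mathcal F\subseteq 2^{[n]}$ is $2^{(1+o(1))\binom{n}{\lfloor n/2\rfloor}}$ as $n\to\infty$. (ii) For every fixed pair of positive integers $s,t$, the number of induced $K_{s,1,t}$-free families $\mathcal F\subseteq 2^{[n]}$ is $2^{(2+o(1))\binom{n}{\lfloor n/2\rfloor}}$ as $n\to\infty$.
   Context: For a finite poset $(P,\le)$ and $\mathcal F\subseteq 2^{[n]}$, an induced copy of $P$ in $\mathcal F$ is a subfamily $\mathcal G\subseteq\mathcal F$ with a bijection $i:P\to\mathcal G$ such that for all $p,q$, $p\le q$ iff $i(p)\subseteq i(q)$; $\mathcal F$ is induced $P$-free if it contains no induced copy of $P$. $\vee_r$ is the poset on elements $a,b_1,\dots,b_r$ with $a<b_j$ for all $j$ and the $b_j$ pairwise incomparable. $K_{s,1,t}$ is the poset on $a_1,\dots,a_s,b,c_1,\dots,c_t$ with $a_j<b<c_k$ for all $j,k$, the $a_j$ pairwise incomparable and the $c_k$ pairwise incomparable. *)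

theory Defs
  imports Complex_Main
begin

(* A finite poset is given by a carrier A and an order relation r with
   finite A and partial_order_on A r. *)

definition induced_copy :: "'a set \<Rightarrow> 'a rel \<Rightarrow> nat set set \<Rightarrow> bool" where
  "induced_copy A r G \<longleftrightarrow>
     (\<exists>i. bij_betw i A G \<and> (\<forall>p\<in>A. \<forall>q\<in>A. (p, q) \<in> r \<longleftrightarrow> i p \<subseteq> i q))"

definition induced_free :: "'a set \<Rightarrow> 'a rel \<Rightarrow> nat set set \<Rightarrow> bool" where
  "induced_free A r F \<longleftrightarrow> \<not> (\<exists>G\<subseteq>F. induced_copy A r G)"

definition induced_free_families :: "'a set \<Rightarrow> 'a rel \<Rightarrow> nat \<Rightarrow> nat set set set" where
  "induced_free_families A r n = {F. F \<subseteq> Pow {1..n} \<and> induced_free A r F}"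

datatype vee_elem = VA | VB nat

definition vee_carrier :: "nat \<Rightarrow> vee_elem set" where
  "vee_carrier r = insert VA (VB ` {1..r})"

definition vee_order :: "nat \<Rightarrow> vee_elem rel" where
  "vee_order r = Id_on (vee_carrier r) \<union> {VA} \<times> (VB ` {1..r})"

datatype K_elem = KA nat | KB | KC nat

definition K_carrier :: "nat \<Rightarrow> nat \<Rightarrow> K_elem set" where
  "K_carrier s t = KA ` {1..s} \<union> {KB} \<union> KC ` {1..t}"

definition K_order :: "nat \<Rightarrow> nat \<Rightarrow> K_elem rel" where
  "K_order s t = Id_on (K_carrier s t) \<union> (KA ` {1..s}) \<times> {KB} \<union> {KB} \<times> (KC ` {1..t})
     \<union> (KA ` {1..s}) \<times> (KC ` {1..t})"

lemma vee_poset: "finite (vee_carrier r)" "partial_order_on (vee_carrier r) (vee_order r)"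
  by (auto simp: vee_carrier_def vee_order_def partial_order_on_def preorder_on_def
        refl_on_def trans_def antisym_def)

lemma K_poset: "finite (K_carrier s t)" "partial_order_on (K_carrier s t) (K_order s t)"
  by (auto simp: K_carrier_def K_order_def partial_order_on_def preorder_on_def
        refl_on_def trans_def antisym_def)

lemma finite_induced_free_families: "finite (induced_free_families A r n)"
  by (rule finite_subset[of _ "Pow (Pow {1..n})"]) (auto simp: induced_free_families_def)

(* N n = 2 ^ ((c + o(1)) * (n choose (n div 2))) as n tends to infinity *)
definition two_power_central_binomial_asymp :: "real \<Rightarrow> (nat \<Rightarrow> nat) \<Rightarrow> bool" where
  "two_power_central_binomial_asymp c N \<longleftrightarrow>
     (\<exists>\<epsilon> :: nat \<Rightarrow> real. \<epsilon> \<longlonglongrightarrow> 0 \<and>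
       (\<forall>\<^sub>F n in sequentially.
          real (N n) = 2 powr ((c + \<epsilon> n) * real (n choose (n div 2)))))"

end

theory Submission
  imports Defs "HOL-Analysis.Convex" "HOL-Combinatorics.Multiset_Permutations" "HOL-Real_Asymp.Real_Asymp"
begin

text \<open>
  Write \<open>N\<close> for the central binomial coefficient. The lower bounds come from the subfamilies of the middle
  level and of two adjacent middle levels.

  For the upper bound in (i), a second moment computation along a random maximal chain shows that a
  family \<open>A\<close> of at least \<open>(1 + \<epsilon>) N\<close> sets, none of which has complement smaller than \<open>s\<close>, contains a set
  \<open>a\<close> with at least \<open>c s |A| / N\<close> supersets in \<open>A\<close> of one common size. These supersets form an antichain,
  so a family that is free of the induced fan with \<open>r\<close> prongs and contains \<open>a\<close> meets them in fewer than
  \<open>r\<close> sets. Branching on whether \<open>a\<close> belongs to the family, and recording that small trace if it does,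
  the family \<open>A\<close> of candidates shrinks by a constant factor after every \<open>N / (c s)\<close> positive branches, hence
  drops below \<open>(1 + \<epsilon>) N\<close> after \<open>O(N log n / s)\<close> of them, each of which costs \<open>O(log n)\<close> bits.
  With \<open>s\<close> about \<open>sqrt n\<close>, both this cost and the number of sets with complement smaller than \<open>s\<close> are \<open>o(N)\<close>.

  For (ii), the members of a family that are not the bottom of an induced fan with \<open>t\<close> prongs form a family
  free of that fan; in the absence of \<open>K_{s,1,t}\<close> the remaining members are not the top of an inverted fan with
  \<open>s\<close> prongs, so their complements form a family free of the fan with \<open>s\<close> prongs. Now (i) applies twice.
\<close>

section \<open>Hereditary families\<close>

text \<open>The weight \<open>(1 + x) ^ card A\<close> pays for the branches \<open>v \<notin> F\<close> and the factor \<open>Q / x\<close> for each branch \<open>v \<in> F\<close>,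
  so no sum over sets of branching positions is needed.\<close>

lemma card_hereditary_le:
  fixes P :: "'a set" and H :: "'a set set" and m \<beta> Q x :: real
  assumes finP: "finite P"
    and hered: "\<And>F G. F \<in> H \<Longrightarrow> G \<subseteq> F \<Longrightarrow> G \<in> H"
    and step: "\<And>A. A \<subseteq> P \<Longrightarrow> m < real (card A) \<Longrightarrow>
      \<exists>v\<in>A. \<exists>W. W \<subseteq> A - {v} \<and> \<beta> * real (card A) \<le> real (card W) \<and>
        real (card ((\<lambda>F. F \<inter> W) ` {F \<in> H. v \<in> F})) \<le> Q"
    and x: "0 < x" "x \<le> Q" and m: "0 \<le> m"
  assumes "A \<subseteq> P" and "real (card A) \<le> m * exp (\<beta> * real k)"
  shows "real (card {F \<in> H. F \<subseteq> A}) \<le> 2 powr m * (Q / x) ^ k * (1 + x) ^ card A"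
  using assms(7,8)
proof (induction "card A" arbitrary: A k rule: less_induct)
  case less
  have finA: "finite A" using less.prems(1) finP finite_subset by blast
  have Q: "1 \<le> Q / x" using x by (simp add: field_simps)
  have finH: "finite {F \<in> H. F \<subseteq> B}" if "finite B" for B
    using that by (auto intro: finite_subset[of _ "Pow B"])
  show ?case
  proof (cases "real (card A) \<le> m")
    case True
    \<comment> \<open>Below the threshold nothing is branched on: all subsets of \<open>A\<close>
      are counted, and the other two factors are at least 1.\<close>
    have "card {F \<in> H. F \<subseteq> A} \<le> card (Pow A)"
      using finA by (intro card_mono) auto
    then have "real (card {F \<in> H. F \<subseteq> A}) \<le> real (2 ^ card A)"
      by (simp only: of_nat_le_iff card_Pow[OF finA])
    also have "\<dots> = 2 powr real (card A)" by (simp add: powr_realpow)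
    also have "\<dots> \<le> 2 powr m" using True by simp
    also have "\<dots> \<le> 2 powr m * ((Q / x) ^ k * (1 + x) ^ card A)"
    proof -
      have "1 \<le> (Q / x) ^ k" using Q by simp
      moreover have "1 \<le> (1 + x) ^ card A" using x by simp
      ultimately have "1 * 1 \<le> (Q / x) ^ k * (1 + x) ^ card A"
        by (intro mult_mono) auto
      then show ?thesis by simp
    qed
    finally show ?thesis by (simp add: mult.assoc)
  next
    case False
    then obtain v W where v: "v \<in> A" and W: "W \<subseteq> A - {v}"
      and cW: "\<beta> * real (card A) \<le> real (card W)"
      and traces: "real (card ((\<lambda>F. F \<inter> W) ` {F \<in> H. v \<in> F})) \<le> Q"
      using step[OF less.prems(1)] by (metis not_le)
    \<comment> \<open>For \<open>k = 0\<close> the size bound would read \<open>card A\<close> at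
      most \<open>m\<close>, which this case excludes.\<close>
    have "k \<noteq> 0" using False less.prems(2) by (cases k) auto
    then obtain l where k: "k = Suc l" by (cases k) auto
    \<comment> \<open>\<open>A1\<close> holds the candidates left when \<open>v\<close> is rejected,
      \<open>A2\<close> those left when \<open>v\<close> is chosen and the trace on \<open>W\<close>
      is recorded.\<close>
    define A1 where "A1 = A - {v}"
    define A2 where "A2 = A - {v} - W"
    have sub: "A1 \<subseteq> P" "A2 \<subseteq> P" "finite A1" "finite A2"
      using less.prems(1) finA by (auto simp: A1_def A2_def)
    have card1: "Suc (card A1) = card A"
      unfolding A1_def using v finA by (rule card_Suc_Diff1[rotated])
    have A2le: "card A2 \<le> card A1"
      unfolding A1_def A2_def using finA by (intro card_mono) auto
    have finW: "finite W" using W finA finite_subset by blast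
    have "card A2 = card A1 - card W"
      unfolding A1_def A2_def using W finW by (simp add: card_Diff_subset)
    moreover have "card W \<le> card A1"
      unfolding A1_def using W finA by (intro card_mono) auto
    ultimately have "real (card A2) \<le> real (card A) - real (card W)" using card1 by linarith
    also have "\<dots> \<le> (1 - \<beta>) * real (card A)" using cW by (simp add: algebra_simps)
    \<comment> \<open>Via \<open>1 - \<beta> \<le> exp (- \<beta>)\<close>, the loss of
      \<open>W\<close> pays for lowering \<open>k\<close> to \<open>l\<close>.\<close>
    also have "\<dots> \<le> exp (- \<beta>) * real (card A)"
      using exp_ge_add_one_self[of "-\<beta>"] by (intro mult_right_mono) auto
    also have "\<dots> \<le> exp (- \<beta>) * (m * exp (\<beta> * real k))"
      using less.prems(2) by (intro mult_left_mono) auto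
    also have "\<dots> = m * exp (\<beta> * real l)"
      by (simp add: k algebra_simps flip: exp_add)
    finally have A2k: "real (card A2) \<le> m * exp (\<beta> * real l)" .
    have IH1: "real (card {F \<in> H. F \<subseteq> A1}) \<le> 2 powr m * (Q / x) ^ k * (1 + x) ^ card A1"
      using card1 less.prems(2) by (intro less.hyps) (auto simp: sub)
    have "real (card {F \<in> H. F \<subseteq> A2}) \<le> 2 powr m * (Q / x) ^ l * (1 + x) ^ card A2"
      using card1 A2le A2k by (intro less.hyps) (auto simp: sub)
    also have "\<dots> \<le> 2 powr m * (Q / x) ^ l * (1 + x) ^ card A1"
      using A2le x Q by (intro mult_left_mono power_increasing) auto
    finally have IH2: "real (card {F \<in> H. F \<subseteq> A2}) \<le> 2 powr m * (Q / x) ^ l * (1 + x) ^ card A1" .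
    let ?T = "(\<lambda>F. F \<inter> W) ` {F \<in> H. v \<in> F}"
    have finT: "finite ?T" using finW by (auto intro: finite_subset[of _ "Pow W"])
    define f where "f = (\<lambda>(T, G). insert v (T \<union> G) :: 'a set)"
    \<comment> \<open>A set \<open>F\<close> containing \<open>v\<close> is recovered from its trace
      on \<open>W\<close> and the remainder \<open>F - {v} - W\<close>, which lies in
      \<open>A2\<close> and stays in \<open>H\<close> by heredity.\<close>
    have "{F \<in> H. F \<subseteq> A} \<subseteq> {F \<in> H. F \<subseteq> A1} \<union> f ` (?T \<times> {F \<in> H. F \<subseteq> A2})"
    proof
      fix F assume F: "F \<in> {F \<in> H. F \<subseteq> A}"
      show "F \<in> {F \<in> H. F \<subseteq> A1} \<union> f ` (?T \<times> {F \<in> H. F \<subseteq> A2})"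
      proof (cases "v \<in> F")
        case True
        have "F - {v} - W \<in> H" using F hered[of F "F - {v} - W"] by blast
        moreover have "F - {v} - W \<subseteq> A2" using F unfolding A2_def by blast
        moreover have "F \<inter> W \<in> ?T" using F True by blast
        ultimately have "(F \<inter> W, F - {v} - W) \<in> ?T \<times> {F \<in> H. F \<subseteq> A2}"
          by blast
        moreover have "F = f (F \<inter> W, F - {v} - W)" using True by (auto simp: f_def)
        ultimately show ?thesis by blast
      next
        case False
        then show ?thesis using F by (auto simp: A1_def)
      qed
    qed
    then have "card {F \<in> H. F \<subseteq> A} \<le> card ({F \<in> H. F \<subseteq> A1} \<union> f ` (?T \<times> {F \<in> H. F \<subseteq> A2}))"
      using finT finH sub by (intro card_mono) auto
    also have "\<dots> \<le> card {F \<in> H. F \<subseteq> A1} + card (f ` (?T \<times> {F \<in> H. F \<subseteq> A2}))"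
      by (rule card_Un_le)
    also have "card (f ` (?T \<times> {F \<in> H. F \<subseteq> A2})) \<le> card ?T * card {F \<in> H. F \<subseteq> A2}"
      using card_image_le[of "?T \<times> {F \<in> H. F \<subseteq> A2}" f] finT finH[OF sub(4)]
      by (simp add: card_cartesian_product)
    finally have "real (card {F \<in> H. F \<subseteq> A})
        \<le> real (card {F \<in> H. F \<subseteq> A1}) + real (card ?T) * real (card {F \<in> H. F \<subseteq> A2})"
      by (simp flip: of_nat_mult of_nat_add)
    also have "\<dots> \<le> 2 powr m * (Q / x) ^ k * (1 + x) ^ card A1
        + Q * (2 powr m * (Q / x) ^ l * (1 + x) ^ card A1)"
      using IH1 IH2 traces x by (intro add_mono mult_mono) auto
    \<comment> \<open>As \<open>Q * (Q / x) ^ l = x * (Q / x) ^ k\<close>, the two branches together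
      gain a factor \<open>1 + x\<close>, exactly the power missing between \<open>card A1\<close>
      and \<open>card A\<close>.\<close>
    also have "\<dots> = 2 powr m * (Q / x) ^ k * (1 + x) ^ card A"
    proof -
      define q where "q = Q / x"
      have "Q = x * q" using x by (simp add: q_def)
      then show ?thesis
        unfolding card1[symmetric] k q_def[symmetric] power_Suc by (simp only: ring_distribs mult_1_left ac_simps)
    qed
    finally show ?thesis .
  qed
qed

section \<open>Supersaturation along maximal chains\<close>

text \<open>A permutation of \<open>S\<close> encodes the maximal chain of its prefixes, so this
  counts the chains through \<open>a\<close> and \<open>b\<close>. Such a permutation is a
  concatenation of arbitrary permutations of \<open>a\<close>, \<open>b - a\<close> and
  \<open>S - b\<close>.\<close>

lemma card_permutations_prefix2:
  assumes "finite S" "b \<subseteq> S" "a \<subseteq> b"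
  shows "card {xs \<in> permutations_of_set S. set (take (card a) xs) = a \<and> set (take (card b) xs) = b}
    = fact (card a) * fact (card b - card a) * fact (card S - card b)"
proof -
  have fin: "finite a" "finite b" "finite (b - a)" "finite (S - b)"
    using assms finite_subset by (auto dest: finite_subset)
  let ?X = "{xs \<in> permutations_of_set S. set (take (card a) xs) = a \<and> set (take (card b) xs) = b}"
  let ?Y = "permutations_of_set a \<times> permutations_of_set (b - a) \<times> permutations_of_set (S - b)"
  have len: "length x = card A" if "x \<in> permutations_of_set A" for x :: "'a list" and A
    using that distinct_card by (fastforce simp: permutations_of_set_def)
  have cab: "card b = card a + card (b - a)"
    using assms fin by (metis card_Diff_subset card_mono le_add_diff_inverse)
  have "bij_betw (\<lambda>(x, y, z). x @ y @ z) ?Y ?X"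
  proof (rule bij_betw_byWitness[where f' = "\<lambda>xs. (take (card a) xs, take (card (b - a)) (drop (card a) xs), drop (card b) xs)"])
    show "\<forall>p\<in>?Y. (\<lambda>xs. (take (card a) xs, take (card (b - a)) (drop (card a) xs), drop (card b) xs))
        ((\<lambda>(x, y, z). x @ y @ z) p) = p"
      using len by (auto simp: cab)
    show "\<forall>xs\<in>?X. (\<lambda>(x, y, z). x @ y @ z)
        ((\<lambda>xs. (take (card a) xs, take (card (b - a)) (drop (card a) xs), drop (card b) xs)) xs) = xs"
      by (auto simp: cab) (metis append_take_drop_id drop_drop add.commute)
    show "(\<lambda>(x, y, z). x @ y @ z) ` ?Y \<subseteq> ?X"
    proof clarify
      fix x y z assume xyz: "x \<in> permutations_of_set a" "y \<in> permutations_of_set (b - a)"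
        "z \<in> permutations_of_set (S - b)"
      have "set (x @ y @ z) = S" "distinct (x @ y @ z)"
        using xyz assms by (auto simp: permutations_of_set_def)
      moreover have "set (take (card a) (x @ y @ z)) = a"
        using xyz len[OF xyz(1)] by (simp add: permutations_of_set_def)
      moreover have "set (take (card b) (x @ y @ z)) = b"
        using xyz len[OF xyz(1)] len[OF xyz(2)] assms by (auto simp: permutations_of_set_def cab)
      ultimately show "x @ y @ z \<in> permutations_of_set S \<and> set (take (card a) (x @ y @ z)) = a
          \<and> set (take (card b) (x @ y @ z)) = b"
        by (simp add: permutations_of_set_def)
    qed
    show "(\<lambda>xs. (take (card a) xs, take (card (b - a)) (drop (card a) xs), drop (card b) xs)) ` ?X \<subseteq> ?Y"
    proof (rule image_subsetI)
      fix xs assume xs: "xs \<in> ?X"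
      then have S: "set xs = S" and d: "distinct xs" and ta: "set (take (card a) xs) = a"
        and tb: "set (take (card b) xs) = b"
        by (auto simp: permutations_of_set_def)
      have "take (card b) xs = take (card a) xs @ take (card (b - a)) (drop (card a) xs)"
        by (simp add: cab take_add)
      moreover have "distinct (take (card b) xs)" using d by simp
      ultimately have "set (take (card (b - a)) (drop (card a) xs)) = b - a"
        using ta tb by auto
      moreover have "set (drop (card b) xs) = S - b"
      proof -
        have "set xs = b \<union> set (drop (card b) xs)"
          using tb by (metis append_take_drop_id set_append)
        moreover have "b \<inter> set (drop (card b) xs) = {}"
          using d tb by (metis append_take_drop_id distinct_append)
        ultimately show ?thesis using S by blast
      qed
      ultimately show "(take (card a) xs, take (card (b - a)) (drop (card a) xs), drop (card b) xs) \<in> ?Y"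
        using ta d by (simp add: permutations_of_set_def)
    qed
  qed
  then have "card ?X = card ?Y" by (rule bij_betw_same_card[symmetric])
  also have "\<dots> = fact (card a) * (fact (card (b - a)) * fact (card (S - b)))"
    using fin by (simp add: card_cartesian_product)
  also have "card (b - a) = card b - card a" using fin assms by (simp add: card_Diff_subset)
  also have "card (S - b) = card S - card b" using fin assms by (simp add: card_Diff_subset)
  finally show ?thesis by (simp add: mult.assoc)
qed

section \<open>Sums of reciprocal binomial coefficients\<close>

lemma choose_two_le_binomial:
  assumes "2 \<le> j" "j + 2 \<le> m"
  shows "m choose 2 \<le> m choose j"
proof (cases "2 * j \<le> m")
  case True
  then show ?thesis using assms by (intro binomial_mono) auto
next
  case False
  then have "m choose 2 \<le> m choose (m - j)" using assms by (intro binomial_mono) auto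
  then show ?thesis using assms by (simp flip: binomial_symmetric)
qed

text \<open>The terms \<open>j = 1\<close> and \<open>j = m - 1\<close> contribute
  \<open>1 / m\<close> each. Every other term is at most \<open>1 / (m choose 2)\<close>, and
  \<open>m - 1\<close> times this is \<open>2 / m\<close>.\<close>

lemma sum_inverse_binomial_le:
  "(\<Sum>j\<in>{1..<m}. 1 / real (m choose j)) \<le> 4 / real m"
proof (cases "m \<ge> 2")
  case False
  then have "{1..<m} = {}" by auto
  then show ?thesis by simp
next
  case True
  have c2: "real (m choose 2) = real m * (real m - 1) / 2"
    using True by (simp add: choose_two real_of_nat_div of_nat_diff)
  define c where "c = 2 / (real m * (real m - 1))"
  have c: "c \<ge> 0" using True by (simp add: c_def)
  have le: "1 / real (m choose j) \<le> (if j = 1 then 1 / real m else 0) + (if j = m - 1 then 1 / real m else 0) + c"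
    if "j \<in> {1..<m}" for j
  proof (cases "j = 1 \<or> j = m - 1")
    case True
    then have "m choose j = m"
      using that binomial_symmetric[of 1 m] by auto
    then show ?thesis using True c by auto
  next
    case False
    then have "m choose 2 \<le> m choose j" using that by (intro choose_two_le_binomial) auto
    then have "1 / real (m choose j) \<le> 1 / real (m choose 2)"
      using True that by (intro divide_left_mono) (auto simp: zero_less_binomial)
    also have "\<dots> = c" by (simp add: c2 c_def)
    finally show ?thesis using False by simp
  qed
  have "(\<Sum>j\<in>{1..<m}. 1 / real (m choose j))
      \<le> (\<Sum>j\<in>{1..<m}. (if j = 1 then 1 / real m else 0) + (if j = m - 1 then 1 / real m else 0) + c)"
    by (intro sum_mono le)
  also have "\<dots> = 1 / real m + 1 / real m + (real m - 1) * c"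
    using True by (simp add: sum.distrib of_nat_diff)
  also have "\<dots> = 4 / real m"
    using True by (simp add: c_def field_simps)
  finally show ?thesis .
qed

text \<open>Second moment method. Let X be the number of members of \<open>A\<close> on a uniformly
  random maximal chain, so the left side is E[X]. Given \<open>a\<close> on the chain, each level
  above it offers at most \<open>\<theta>\<close> members, each hit with probability a reciprocal
  binomial coefficient. Hence E[X^2] is at most E[X] times the right side, and E[X]^2 \<le> E[X^2]
  concludes.\<close>

lemma supersaturation:
  fixes A :: "'a set set" and \<theta> :: real
  assumes finS: "finite S" and AS: "A \<subseteq> Pow S" and s: "s \<ge> 1" and \<theta>: "0 \<le> \<theta>"
    and top: "\<And>a. a \<in> A \<Longrightarrow> card a + s \<le> card S"
    and deg: "\<And>a l. a \<in> A \<Longrightarrow> real (card {b \<in> A. a \<subset> b \<and> card b = l}) \<le> \<theta>"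
  shows "(\<Sum>a\<in>A. 1 / real (card S choose card a)) \<le> 1 + 8 * \<theta> / real s"
proof (cases "A = {}")
  case True
  then show ?thesis using \<theta> by simp
next
  case False
  define n where "n = card S"
  define \<mu> where "\<mu> = (\<Sum>a\<in>A. 1 / real (n choose card a))"
  define L where "L = permutations_of_set S"
  \<comment> \<open>Everything is counted rather than normalised: \<open>I a xs\<close> says that
    the chain of \<open>xs\<close> contains \<open>a\<close>, \<open>p a\<close> is the number of
    chains through \<open>a\<close>, and \<open>q a b\<close> the number through both sets.\<close>
  define I where "I = (\<lambda>(a :: 'a set) xs. of_bool (set (take (card a) xs) = a) :: real)"
  define p where "p = (\<lambda>a :: 'a set. fact n / real (n choose card a))"
  define q where "q = (\<lambda>a b. \<Sum>xs\<in>L. I a xs * I b xs)"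
  have finA: "finite A" using AS finS by (meson finite_Pow_iff finite_subset)
  have finL: "finite L" by (simp add: L_def)
  have card_le: "card a \<le> n" if "a \<in> A" for a
    using that AS finS by (auto simp: n_def intro: card_mono)
  have p_pos: "p a > 0" if "a \<in> A" for a using card_le[OF that] by (simp add: p_def zero_less_binomial)
  have q_chain: "q a b = fact (card a) * fact (card b - card a) * fact (n - card b)"
    if "a \<subseteq> b" "b \<in> A" for a b
  proof -
    have "q a b = (\<Sum>xs\<in>L. of_bool (set (take (card a) xs) = a \<and> set (take (card b) xs) = b))"
      unfolding q_def I_def by (intro sum.cong) auto
    also have "\<dots> = real (card {xs \<in> L. set (take (card a) xs) = a \<and> set (take (card b) xs) = b})"
      using finL by (simp add: Int_def)
    also have "\<dots> = fact (card a) * fact (card b - card a) * fact (n - card b)"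
      unfolding L_def n_def using that AS finS by (subst card_permutations_prefix2) auto
    finally show ?thesis .
  qed
  have q_same: "q a a = p a" if "a \<in> A" for a
    using q_chain[of a a] that card_le[OF that] by (simp add: p_def binomial_fact field_simps)
  have q_less: "q a b = p a * (1 / real ((n - card a) choose (card b - card a)))"
    if "a \<in> A" "b \<in> A" "a \<subset> b" for a b
  proof -
    have "card a \<le> card b"
      using that AS finS by (meson PowD card_mono finite_subset psubset_imp_subset subsetD)
    then show ?thesis
      using q_chain[of a b] that card_le[OF that(1)] card_le[OF that(2)]
      by (simp add: p_def binomial_fact field_simps)
  qed
  \<comment> \<open>Prefixes of one permutation are nested, so no chain contains two incomparable
    sets.\<close>
  have q_incomp: "q a b = 0" if "\<not> a \<subseteq> b" "\<not> b \<subseteq> a" for a b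
  proof -
    have "I a xs * I b xs = 0" for xs
      using that set_take_subset_set_take[of "card a" "card b" xs]
        set_take_subset_set_take[of "card b" "card a" xs]
      by (cases "card a \<le> card b") (auto simp: I_def)
    then show ?thesis unfolding q_def by (intro sum.neutral) blast
  qed
  have q_sym: "q a b = q b a" for a b by (simp add: q_def mult.commute)
  have I_sum: "(\<Sum>xs\<in>L. I a xs) = q a a" for a
    unfolding q_def by (intro sum.cong) (auto simp: I_def)
  have "(\<Sum>xs\<in>L. \<Sum>a\<in>A. I a xs) = (\<Sum>a\<in>A. q a a)"
    by (subst sum.swap) (simp add: I_sum)
  also have "\<dots> = fact n * \<mu>"
    unfolding \<mu>_def sum_distrib_left by (intro sum.cong) (auto simp: q_same p_def)
  finally have first: "(\<Sum>xs\<in>L. \<Sum>a\<in>A. I a xs) = fact n * \<mu>" .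
  have sum_p: "(\<Sum>a\<in>A. p a) = fact n * \<mu>"
    unfolding \<mu>_def sum_distrib_left by (intro sum.cong) (auto simp: p_def)
  have up: "(\<Sum>b\<in>{b \<in> A. a \<subset> b}. q a b) \<le> p a * (4 * \<theta> / real s)" if a: "a \<in> A" for a
  proof -
    define m where "m = n - card a"
    have m: "m \<ge> s" "m > 0" using top[OF a] s by (auto simp: m_def n_def)
    define g where "g = (\<lambda>b :: 'a set. card b - card a)"
    \<comment> \<open>Applying \<open>top\<close> to \<open>b\<close> rules out
      \<open>b = S\<close>. The range therefore stops before \<open>m\<close>, where the reciprocal
      binomial would be 1.\<close>
    have g: "g b \<in> {1..<m} \<and> card b = card a + g b" if "b \<in> {b \<in> A. a \<subset> b}" for b
    proof -
      have "finite b" using that AS finS by (auto intro: finite_subset[of b S])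
      then have "card a < card b" using that by (auto intro: psubset_card_mono)
      then show ?thesis using top[of b] that s by (auto simp: g_def m_def n_def)
    qed
    have "(\<Sum>b\<in>{b \<in> A. a \<subset> b}. q a b) = (\<Sum>b\<in>{b \<in> A. a \<subset> b}. p a * (1 / real (m choose g b)))"
      using q_less a by (intro sum.cong) (auto simp: m_def g_def)
    also have "\<dots> = (\<Sum>j\<in>{1..<m}. \<Sum>b\<in>{b \<in> {b \<in> A. a \<subset> b}. g b = j}. p a * (1 / real (m choose g b)))"
    proof (rule sum.group[symmetric])
      show "g ` {b \<in> A. a \<subset> b} \<subseteq> {1..<m}" using g by blast
    qed (use finA in auto)
    also have "\<dots> \<le> (\<Sum>j\<in>{1..<m}. p a * \<theta> * (1 / real (m choose j)))"
    proof (rule sum_mono)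
      fix j assume j: "j \<in> {1..<m}"
      have "(\<Sum>b\<in>{b \<in> {b \<in> A. a \<subset> b}. g b = j}. p a * (1 / real (m choose g b)))
          = (\<Sum>b\<in>{b \<in> {b \<in> A. a \<subset> b}. g b = j}. p a * (1 / real (m choose j)))"
        by (intro sum.cong) auto
      also have "\<dots> = real (card {b \<in> {b \<in> A. a \<subset> b}. g b = j}) * (p a * (1 / real (m choose j)))"
        by simp
      also have "\<dots> \<le> real (card {b \<in> A. a \<subset> b \<and> card b = card a + j}) * (p a * (1 / real (m choose j)))"
      proof (intro mult_right_mono of_nat_mono card_mono)
        show "{b \<in> {b \<in> A. a \<subset> b}. g b = j} \<subseteq> {b \<in> A. a \<subset> b \<and> card b = card a + j}"
          using g by blast
      qed (use finA p_pos[OF a] in auto)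
      also have "\<dots> \<le> \<theta> * (p a * (1 / real (m choose j)))"
        using deg[OF a] p_pos[OF a] by (intro mult_right_mono) auto
      finally show "(\<Sum>b\<in>{b \<in> {b \<in> A. a \<subset> b}. g b = j}. p a * (1 / real (m choose g b)))
          \<le> p a * \<theta> * (1 / real (m choose j))" by (simp add: mult_ac)
    qed
    also have "\<dots> = p a * \<theta> * (\<Sum>j\<in>{1..<m}. 1 / real (m choose j))"
      by (simp only: sum_distrib_left)
    also have "\<dots> \<le> p a * \<theta> * (4 / real m)"
      using p_pos[OF a] \<theta> by (intro mult_left_mono sum_inverse_binomial_le) auto
    also have "\<dots> \<le> p a * \<theta> * (4 / real s)"
      using p_pos[OF a] \<theta> m s by (intro mult_left_mono divide_left_mono) auto
    finally show ?thesis by (simp add: mult_ac)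
  qed
  have ups: "(\<Sum>a\<in>A. \<Sum>b\<in>{b \<in> A. a \<subset> b}. q a b) \<le> fact n * \<mu> * (4 * \<theta> / real s)"
    unfolding sum_p[symmetric] sum_distrib_right by (intro sum_mono up)
  \<comment> \<open>The same pairs read from the other end; counting them twice turns the constant 4
    into 8.\<close>
  have downs: "(\<Sum>a\<in>A. \<Sum>b\<in>{b \<in> A. b \<subset> a}. q a b) = (\<Sum>a\<in>A. \<Sum>b\<in>{b \<in> A. a \<subset> b}. q a b)"
    by (subst sum.swap_restrict[OF finA finA]) (simp add: q_sym)
  have split: "(\<Sum>b\<in>A. q a b) = q a a + (\<Sum>b\<in>{b \<in> A. a \<subset> b}. q a b) + (\<Sum>b\<in>{b \<in> A. b \<subset> a}. q a b)"
    if a: "a \<in> A" for a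
  proof -
    have "(\<Sum>b\<in>A. q a b) = (\<Sum>b\<in>insert a ({b \<in> A. a \<subset> b} \<union> {b \<in> A. b \<subset> a}). q a b)"
      using finA a q_incomp by (intro sum.mono_neutral_right) auto
    also have "\<dots> = q a a + (\<Sum>b\<in>{b \<in> A. a \<subset> b} \<union> {b \<in> A. b \<subset> a}. q a b)"
      using finA by (subst sum.insert) auto
    also have "(\<Sum>b\<in>{b \<in> A. a \<subset> b} \<union> {b \<in> A. b \<subset> a}. q a b)
        = (\<Sum>b\<in>{b \<in> A. a \<subset> b}. q a b) + (\<Sum>b\<in>{b \<in> A. b \<subset> a}. q a b)"
      using finA by (intro sum.union_disjoint) auto
    finally show ?thesis by (simp add: add.assoc)
  qed
  have "(\<Sum>xs\<in>L. (\<Sum>a\<in>A. I a xs)\<^sup>2) = (\<Sum>a\<in>A. \<Sum>b\<in>A. q a b)"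
    unfolding q_def power2_eq_square sum_product
    by (subst sum.swap, intro sum.cong refl, subst sum.swap) simp
  also have "\<dots> = (\<Sum>a\<in>A. q a a) + (\<Sum>a\<in>A. \<Sum>b\<in>{b \<in> A. a \<subset> b}. q a b)
      + (\<Sum>a\<in>A. \<Sum>b\<in>{b \<in> A. b \<subset> a}. q a b)"
    using split by (simp add: sum.distrib)
  also have "\<dots> \<le> fact n * \<mu> + 2 * (fact n * \<mu> * (4 * \<theta> / real s))"
    using ups q_same sum_p unfolding downs by simp
  finally have second: "(\<Sum>xs\<in>L. (\<Sum>a\<in>A. I a xs)\<^sup>2) \<le> fact n * \<mu> * (1 + 8 * \<theta> / real s)"
    by (simp add: algebra_simps)
  \<comment> \<open>Cauchy-Schwarz over the \<open>fact n\<close> permutations.\<close>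
  have "(fact n * \<mu>)\<^sup>2 \<le> (\<Sum>xs\<in>L. (\<Sum>a\<in>A. I a xs)\<^sup>2) * real (card L)"
    unfolding first[symmetric] by (rule sum_squared_le_sum_of_squares)
  also have "\<dots> \<le> fact n * \<mu> * (1 + 8 * \<theta> / real s) * real (card L)"
    using second by (intro mult_right_mono) auto
  also have "real (card L) = fact n"
    using finS by (simp add: L_def n_def)
  finally have "(fact n * fact n * \<mu>) * \<mu> \<le> (fact n * fact n * \<mu>) * (1 + 8 * \<theta> / real s)"
    by (simp add: power2_eq_square mult_ac)
  moreover have "\<mu> > 0"
    unfolding \<mu>_def using finA False card_le by (intro sum_pos) (auto simp: zero_less_binomial)
  ultimately show ?thesis
    unfolding \<mu>_def[symmetric] n_def[symmetric] by (simp add: mult_le_cancel_left_pos)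
qed

section \<open>Induced copies\<close>

text \<open>Being free of the induced fan with \<open>r\<close> prongs, phrased inside the family
  instead of through embeddings; \<open>induced_free_vee_iff\<close> gives the equivalence for
  \<open>r \<ge> 1\<close>.\<close>

definition up_free :: "nat \<Rightarrow> 'a set set \<Rightarrow> bool" where
  "up_free r F \<longleftrightarrow> \<not> (\<exists>a\<in>F. \<exists>B\<subseteq>F. card B = r \<and> (\<forall>b\<in>B. a \<subset> b) \<and> (\<forall>b\<in>B. \<forall>c\<in>B. b \<subseteq> c \<longrightarrow> b = c))"

text \<open>Injectivity of \<open>i\<close> comes for free: \<open>i p = i q\<close> gives both
  inclusions, hence both relations, and antisymmetry applies.\<close>

lemma not_induced_freeI:
  assumes "i ` A \<subseteq> F" and "\<forall>p\<in>A. \<forall>q\<in>A. (p, q) \<in> R \<longleftrightarrow> i p \<subseteq> i q"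
    and "antisym R"
  shows "\<not> induced_free A R F"
proof -
  have "inj_on i A"
    using assms(2,3) by (auto simp: inj_on_def antisym_def)
  then show ?thesis
    using assms(1,2) unfolding induced_free_def induced_copy_def
    by (auto simp: bij_betw_def intro!: exI[of _ "i ` A"])
qed

lemma not_induced_freeD:
  assumes "\<not> induced_free A R F"
  shows "\<exists>i. i ` A \<subseteq> F \<and> inj_on i A \<and> (\<forall>p\<in>A. \<forall>q\<in>A. (p, q) \<in> R \<longleftrightarrow> i p \<subseteq> i q)"
proof -
  obtain G i where "G \<subseteq> F" "inj_on i A" "i ` A = G" "\<forall>p\<in>A. \<forall>q\<in>A. (p, q) \<in> R \<longleftrightarrow> i p \<subseteq> i q"
    using assms by (auto simp: induced_free_def induced_copy_def bij_betw_def)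
  then show ?thesis by (intro exI[of _ i]) simp
qed

text \<open>The bound \<open>r \<ge> 1\<close> forces \<open>B\<close> to be finite, since infinite
  sets have \<open>card\<close> 0.\<close>

lemma obtain_enumeration:
  assumes "card B = r" "r \<ge> 1"
  obtains g where "bij_betw g {1..r} B"
proof -
  have "finite B" using assms card.infinite by fastforce
  then show ?thesis using assms that
    by (metis card_atLeastAtMost diff_Suc_1 finite_atLeastAtMost finite_same_card_bij)
qed

lemma induced_free_vee_iff:
  assumes "r \<ge> 1"
  shows "induced_free (vee_carrier r) (vee_order r) F \<longleftrightarrow> up_free r F"
proof
  assume free: "induced_free (vee_carrier r) (vee_order r) F"
  show "up_free r F"
    unfolding up_free_def
  proof clarify
    fix a B assume aB: "a \<in> F" "B \<subseteq> F" "r = card B" "\<forall>b\<in>B. a \<subset> b"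
      "\<forall>b\<in>B. \<forall>c\<in>B. b \<subseteq> c \<longrightarrow> b = c"
    obtain g where g: "bij_betw g {1..r} B" using obtain_enumeration aB(3) assms by metis
    have gB: "g j \<in> B" if "j \<in> {1..r}" for j using g that by (auto simp: bij_betw_def)
    have ginj: "g j \<subseteq> g k \<longleftrightarrow> j = k" if "j \<in> {1..r}" "k \<in> {1..r}" for j k
      using g that aB(5) gB by (metis bij_betw_def inj_on_def order_refl)
    define i where "i = (\<lambda>e. case e of VA \<Rightarrow> a | VB j \<Rightarrow> g j)"
    have "\<not> induced_free (vee_carrier r) (vee_order r) F"
    proof (rule not_induced_freeI)
      show "i ` vee_carrier r \<subseteq> F"
        using aB gB by (auto simp: vee_carrier_def i_def)
      have a1: "a \<subseteq> g j" "\<not> g j \<subseteq> a" if "j \<in> {1..r}" for j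
        using gB[OF that] aB(4) by auto
      show "\<forall>p\<in>vee_carrier r. \<forall>q\<in>vee_carrier r. (p, q) \<in> vee_order r \<longleftrightarrow> i p \<subseteq> i q"
        by (simp add: vee_carrier_def vee_order_def i_def ginj a1 image_iff Id_on_iff)
      show "antisym (vee_order r)"
        by (auto simp: vee_order_def antisym_def)
    qed
    then show False using free by simp
  qed
next
  assume "up_free r F"
  show "induced_free (vee_carrier r) (vee_order r) F"
  proof (rule ccontr)
    assume nf: "\<not> induced_free (vee_carrier r) (vee_order r) F"
    obtain i where i: "i ` vee_carrier r \<subseteq> F" "inj_on i (vee_carrier r)"
      "\<forall>p\<in>vee_carrier r. \<forall>q\<in>vee_carrier r. (p, q) \<in> vee_order r \<longleftrightarrow> i p \<subseteq> i q"
      using not_induced_freeD[OF nf] by (elim exE conjE)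
    define B where "B = (\<lambda>j. i (VB j)) ` {1..r}"
    have inj: "inj_on (\<lambda>j. i (VB j)) {1..r}"
    proof (rule inj_onI)
      fix j k assume "j \<in> {1..r}" "k \<in> {1..r}" "i (VB j) = i (VB k)"
      then have "VB j = VB k"
        using inj_onD[OF i(2), of "VB j" "VB k"] unfolding vee_carrier_def by blast
      then show "j = k" by simp
    qed
    have mem: "i VA \<in> F" "B \<subseteq> F" using i(1) by (auto simp: vee_carrier_def B_def)
    have card: "card B = r" using card_image[OF inj] by (simp add: B_def)
    have above: "i VA \<subset> b" if bB: "b \<in> B" for b
    proof -
      obtain j where j: "b = i (VB j)" "j \<in> {1..r}" using bB unfolding B_def by blast
      have "(VA, VB j) \<in> vee_order r" "(VB j, VA) \<notin> vee_order r"
        using j by (auto simp: vee_order_def)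
      then show ?thesis
        using i(3)[rule_format, of VA "VB j"] i(3)[rule_format, of "VB j" VA] j
        by (auto simp: vee_carrier_def)
    qed
    have anti: "b = c" if bc: "b \<in> B" "c \<in> B" "b \<subseteq> c" for b c
    proof -
      obtain j k where j: "b = i (VB j)" "j \<in> {1..r}" "c = i (VB k)" "k \<in> {1..r}"
        using bc unfolding B_def by blast
      then have "(VB j, VB k) \<in> vee_order r"
        using i(3)[rule_format, of "VB j" "VB k"] bc by (auto simp: vee_carrier_def)
      then show ?thesis using j by (auto simp: vee_order_def)
    qed
    have "\<exists>a\<in>F. \<exists>B\<subseteq>F. card B = r \<and> (\<forall>b\<in>B. a \<subset> b) \<and> (\<forall>b\<in>B. \<forall>c\<in>B. b \<subseteq> c \<longrightarrow> b = c)"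
      using mem(2) card above anti
      by (intro bexI[OF _ mem(1)] exI[of _ B] conjI ballI impI)
    with \<open>up_free r F\<close> show False unfolding up_free_def by (rule notE)
  qed
qed

text \<open>Only the relations with the middle element \<open>b\<close> are assumed; those between
  \<open>B\<close> and \<open>C\<close> follow by transitivity.\<close>

lemma not_induced_free_KI:
  assumes "b \<in> F" "B \<subseteq> F" "C \<subseteq> F" "card B = s" "card C = t" "s \<ge> 1" "t \<ge> 1"
    and "\<And>x. x \<in> B \<Longrightarrow> x \<subset> b" "\<And>x. x \<in> C \<Longrightarrow> b \<subset> x"
    and "\<And>x y. x \<in> B \<Longrightarrow> y \<in> B \<Longrightarrow> x \<subseteq> y \<Longrightarrow> x = y"
    and "\<And>x y. x \<in> C \<Longrightarrow> y \<in> C \<Longrightarrow> x \<subseteq> y \<Longrightarrow> x = y"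
  shows "\<not> induced_free (K_carrier s t) (K_order s t) F"
proof -
  obtain g where g: "bij_betw g {1..s} B" using obtain_enumeration assms(4,6) by metis
  obtain h where h: "bij_betw h {1..t} C" using obtain_enumeration assms(5,7) by metis
  have gB: "g j \<in> B" if "j \<in> {1..s}" for j using g that by (auto simp: bij_betw_def)
  have hC: "h j \<in> C" if "j \<in> {1..t}" for j using h that by (auto simp: bij_betw_def)
  have ginj: "g j \<subseteq> g k \<longleftrightarrow> j = k" if "j \<in> {1..s}" "k \<in> {1..s}" for j k
    using g that assms(10) gB by (metis bij_betw_def inj_on_def order_refl)
  have hinj: "h j \<subseteq> h k \<longleftrightarrow> j = k" if "j \<in> {1..t}" "k \<in> {1..t}" for j k
    using h that assms(11) hC by (metis bij_betw_def inj_on_def order_refl)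
  have g1: "g j \<subseteq> b" "\<not> b \<subseteq> g j" if "j \<in> {1..s}" for j
    using gB[OF that] assms(8) by auto
  have h1: "b \<subseteq> h j" "\<not> h j \<subseteq> b" if "j \<in> {1..t}" for j
    using hC[OF that] assms(9) by auto
  have gh: "g j \<subseteq> h k" "\<not> h k \<subseteq> g j" if "j \<in> {1..s}" "k \<in> {1..t}" for j k
    using g1 h1 that by blast+
  define i where "i = (\<lambda>e. case e of KA j \<Rightarrow> g j | KB \<Rightarrow> b | KC j \<Rightarrow> h j)"
  show ?thesis
  proof (rule not_induced_freeI)
    show "i ` K_carrier s t \<subseteq> F"
      using assms(1-3) gB hC by (auto simp: K_carrier_def i_def)
    show "\<forall>p\<in>K_carrier s t. \<forall>q\<in>K_carrier s t. (p, q) \<in> K_order s t \<longleftrightarrow> i p \<subseteq> i q"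
      by (simp add: K_carrier_def K_order_def i_def ginj hinj g1 h1 gh image_iff Id_on_iff ball_Un)
    show "antisym (K_order s t)"
      by (auto simp: K_order_def antisym_def)
  qed
qed

text \<open>A copy of the poset contains the chain \<open>KA 1\<close>, \<open>KB\<close>,
  \<open>KC 1\<close>, so a family without chains of three sets has none. This serves the lower
  bound in (ii).\<close>

lemma induced_free_KI:
  assumes "\<And>x y z. x \<in> F \<Longrightarrow> y \<in> F \<Longrightarrow> z \<in> F \<Longrightarrow> x \<subset> y \<Longrightarrow> y \<subset> z \<Longrightarrow> False"
    and "s \<ge> 1" "t \<ge> 1"
  shows "induced_free (K_carrier s t) (K_order s t) F"
proof (rule ccontr)
  assume nf: "\<not> induced_free (K_carrier s t) (K_order s t) F"
  obtain i where i: "i ` K_carrier s t \<subseteq> F" "inj_on i (K_carrier s t)"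
    "\<forall>p\<in>K_carrier s t. \<forall>q\<in>K_carrier s t. (p, q) \<in> K_order s t \<longleftrightarrow> i p \<subseteq> i q"
    using not_induced_freeD[OF nf] by (elim exE conjE)
  have mem: "KA 1 \<in> K_carrier s t" "KB \<in> K_carrier s t" "KC 1 \<in> K_carrier s t"
    using assms(2,3) by (auto simp: K_carrier_def)
  have "i (KA 1) \<subset> i KB" "i KB \<subset> i (KC 1)"
    using i(3)[rule_format, OF mem(1,2)] i(3)[rule_format, OF mem(2,1)]
      i(3)[rule_format, OF mem(2,3)] i(3)[rule_format, OF mem(3,2)] assms(2,3)
    by (auto simp: K_order_def)
  then show False using assms(1) i(1) mem by blast
qed

section \<open>Basic properties of fan-free families\<close>

lemma up_free_subset:
  assumes "up_free r F" "G \<subseteq> F"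
  shows "up_free r G"
proof (rule ccontr)
  assume "\<not> up_free r G"
  then obtain a B where "a \<in> G" "B \<subseteq> G" "card B = r" "\<forall>b\<in>B. a \<subset> b"
    "\<forall>b\<in>B. \<forall>c\<in>B. b \<subseteq> c \<longrightarrow> b = c"
    unfolding up_free_def by blast
  moreover from this have "a \<in> F" "B \<subseteq> F" using assms(2) by auto
  ultimately show False using assms(1) unfolding up_free_def by blast
qed

lemma up_free_antichain:
  assumes "\<And>a b. a \<in> F \<Longrightarrow> b \<in> F \<Longrightarrow> \<not> a \<subset> b" "r \<ge> 1"
  shows "up_free r F"
  unfolding up_free_def
proof clarify
  fix a B assume "a \<in> F" "B \<subseteq> F" "\<forall>b\<in>B. a \<subset> b" "r = card B"
  moreover from this have "B \<noteq> {}" using assms(2) by auto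
  ultimately show False using assms(1) by blast
qed

text \<open>Sets of one finite size form an antichain, so \<open>r\<close> members of
  \<open>F\<close> inside \<open>W\<close> would be the prongs of a fan with bottom
  \<open>v\<close>. This is what makes the recorded traces small.\<close>

lemma up_free_card_level:
  assumes "up_free r F" "v \<in> F"
    and W: "\<And>b. b \<in> W \<Longrightarrow> v \<subset> b \<and> finite b \<and> card b = l"
  shows "card (F \<inter> W) < r"
proof (rule ccontr)
  assume "\<not> card (F \<inter> W) < r"
  then have "r \<le> card (F \<inter> W)" by simp
  then obtain B where B: "B \<subseteq> F \<inter> W" "card B = r"
    by (rule obtain_subset_with_card_n)
  have "b = c" if "b \<in> B" "c \<in> B" "b \<subseteq> c" for b c
  proof -
    have "b \<in> W" "c \<in> W" using that B(1) by auto
    then show ?thesis using W[of b] W[of c] card_subset_eq[of c b] that(3) by simp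
  qed
  moreover have "\<forall>b\<in>B. v \<subset> b" "B \<subseteq> F" using B(1) W by auto
  ultimately show False using assms(1,2) B(2) unfolding up_free_def by metis
qed

section \<open>Counting families without fans\<close>

text \<open>A set of at most \<open>r + 1\<close> elements either has at most \<open>r\<close> or
  arises from such a set by one insertion from \<open>W\<close>, so each step costs a factor
  \<open>card W + 1\<close>.\<close>

lemma card_bounded_subsets_le:
  assumes "finite W"
  shows "card {T. T \<subseteq> W \<and> card T \<le> r} \<le> (card W + 1) ^ r"
proof (induction r)
  case 0
  have "{T. T \<subseteq> W \<and> card T \<le> 0} = {{}}"
    using assms finite_subset by fastforce
  then show ?case by simp
next
  case (Suc r)
  let ?X = "{T. T \<subseteq> W \<and> card T \<le> r}"
  have fin: "finite ?X" using assms by (auto intro: finite_subset[of _ "Pow W"])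
  have "{T. T \<subseteq> W \<and> card T \<le> Suc r} \<subseteq> (\<lambda>(x, T). insert x T) ` (W \<times> ?X) \<union> ?X"
  proof
    fix T assume T: "T \<in> {T. T \<subseteq> W \<and> card T \<le> Suc r}"
    show "T \<in> (\<lambda>(x, T). insert x T) ` (W \<times> ?X) \<union> ?X"
    proof (cases "T = {}")
      case False
      then obtain x where x: "x \<in> T" by auto
      have "finite T" using T assms finite_subset by auto
      then have "T - {x} \<in> ?X" using T x by auto
      moreover have "T = (\<lambda>(x, T). insert x T) (x, T - {x})" using x by auto
      ultimately show ?thesis using x T by blast
    qed auto
  qed
  then have "card {T. T \<subseteq> W \<and> card T \<le> Suc r} \<le> card ((\<lambda>(x, T). insert x T) ` (W \<times> ?X) \<union> ?X)"
    using assms fin by (intro card_mono) auto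
  also have "\<dots> \<le> card ((\<lambda>(x, T). insert x T) ` (W \<times> ?X)) + card ?X"
    by (rule card_Un_le)
  also have "\<dots> \<le> card W * card ?X + card ?X"
    using card_image_le[of "W \<times> ?X" "\<lambda>(x, T). insert x T"] assms fin
    by (simp add: card_cartesian_product)
  also have "\<dots> = (card W + 1) * card ?X" by simp
  also have "\<dots> \<le> (card W + 1) * (card W + 1) ^ r" using Suc.IH by (rule mult_le_mono2)
  finally show ?case by simp
qed

section \<open>The cube is only polynomially larger than its middle level\<close>

lemma two_power_le_central_binomial: "2 ^ n \<le> (real n + 1) * real (n choose (n div 2))"
proof -
  have "2 ^ n = (\<Sum>k\<le>n. n choose k)" by (simp add: choose_row_sum)
  also have "\<dots> \<le> (\<Sum>k\<le>n. n choose (n div 2))" by (intro sum_mono binomial_maximum)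
  also have "\<dots> = (n + 1) * (n choose (n div 2))" by simp
  finally have "real (2 ^ n) \<le> real ((n + 1) * (n choose (n div 2)))" by (simp only: of_nat_le_iff)
  then show ?thesis by (simp add: algebra_simps)
qed

lemma central_binomial_pos: "n choose (n div 2) > 0"
  by (simp add: zero_less_binomial)

lemma obtain_dense_level:
  fixes \<epsilon> :: real
  assumes \<epsilon>: "\<epsilon> > 0" and s: "1 \<le> s"
    and A: "A \<subseteq> {a. a \<subseteq> {1..n} \<and> card a + s \<le> n}"
    and big: "(1 + \<epsilon>) * real (n choose (n div 2)) < real (card A)"
  shows "\<exists>a\<in>A. \<exists>l. \<epsilon> * real s / (16 * (1 + \<epsilon>) * real (n choose (n div 2))) * real (card A)
    \<le> real (card {b \<in> A. a \<subset> b \<and> card b = l})"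
proof (rule ccontr)
  assume contra: "\<not> ?thesis"
  let ?N = "real (n choose (n div 2))"
  have N: "?N > 0" using central_binomial_pos by simp
  define \<mu> where "\<mu> = (\<Sum>a\<in>A. 1 / real (n choose card a))"
  have "real (card A) / ?N = (\<Sum>a\<in>A. 1 / ?N)" by simp
  also have "\<dots> \<le> \<mu>"
    unfolding \<mu>_def using A
    by (intro sum_mono divide_left_mono)
       (auto simp: binomial_maximum zero_less_binomial)
  finally have \<mu>_ge: "real (card A) / ?N \<le> \<mu>" .
  have "1 + \<epsilon> < real (card A) / ?N" using big N by (simp add: field_simps)
  then have \<mu>1: "1 + \<epsilon> < \<mu>" using \<mu>_ge by simp
  \<comment> \<open>Taking \<open>\<theta>\<close> proportional to \<open>\<mu>\<close>, which is at
    least \<open>card A / N\<close>, turns the supersaturation bound into the linear inequality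
    \<open>\<mu> \<le> 1 + \<epsilon> / (2 * (1 + \<epsilon>)) * \<mu>\<close>, incompatible with
    \<open>\<mu> > 1 + \<epsilon>\<close>.\<close>
  define \<theta> where "\<theta> = \<epsilon> * real s / (16 * (1 + \<epsilon>)) * \<mu>"
  have \<theta>: "0 \<le> \<theta>" using \<mu>1 \<epsilon> by (simp add: \<theta>_def)
  have "\<epsilon> * real s / (16 * (1 + \<epsilon>) * ?N) * real (card A)
      = \<epsilon> * real s / (16 * (1 + \<epsilon>)) * (real (card A) / ?N)" by simp
  also have "\<dots> \<le> \<theta>" unfolding \<theta>_def using \<mu>_ge \<epsilon> by (intro mult_left_mono) auto
  finally have "real (card {b \<in> A. a \<subset> b \<and> card b = l}) \<le> \<theta>" if "a \<in> A" for a l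
    using contra that by (meson le_cases order_trans)
  then have "\<mu> \<le> 1 + 8 * \<theta> / real s"
    using supersaturation[of "{1..n}" A s \<theta>] A s \<theta> by (auto simp: \<mu>_def)
  also have "8 * \<theta> / real s = \<epsilon> / (2 * (1 + \<epsilon>)) * \<mu>"
  proof -
    define e where "e = 1 + \<epsilon>"
    have "e > 0" using \<epsilon> by (simp add: e_def)
    then show ?thesis unfolding \<theta>_def e_def[symmetric] using s by (simp add: field_simps)
  qed
  finally have "\<mu> * (2 + \<epsilon>) \<le> 2 * (1 + \<epsilon>)" using \<epsilon> by (simp add: field_simps)
  moreover have "(1 + \<epsilon>) * (2 + \<epsilon>) < \<mu> * (2 + \<epsilon>)" using \<mu>1 \<epsilon> by simp
  moreover have "2 * (1 + \<epsilon>) \<le> (1 + \<epsilon>) * (2 + \<epsilon>)" using \<epsilon> by (simp add: algebra_simps)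
  ultimately show False by linarith
qed

text \<open>This is \<open>card_hereditary_le\<close> with threshold
  \<open>(1 + \<epsilon>) * N\<close>. The three factors account for the leftover candidates, the
  recorded traces and the rejected branches.\<close>

lemma card_up_free_lower_le:
  fixes \<epsilon> :: real and n r s :: nat
  defines "N \<equiv> real (n choose (n div 2))"
  defines "P \<equiv> {a. a \<subseteq> {1..n} \<and> card a + s \<le> n}"
  assumes \<epsilon>: "\<epsilon> > 0" and s: "1 \<le> s" "s \<le> n"
  shows "real (card {F. up_free r F \<and> F \<subseteq> P}) \<le>
    2 powr ((1 + \<epsilon>) * N) *
    real (n + 2) powr (real (2 * r + 2) * (ln (real n + 1) * (16 * (1 + \<epsilon>) / \<epsilon> * (N / real s)) + 1)) *
    exp (N / (real n + 2))"
proof -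
  have N: "N > 0" using central_binomial_pos by (simp add: N_def)
  \<comment> \<open>\<open>\<beta>\<close> is the density from \<open>obtain_dense_level\<close>.
    \<open>k\<close> is the number of shrinkings by \<open>exp (- \<beta>)\<close> that bring
    \<open>(n + 1) * N\<close> down to the threshold. \<open>x\<close> is small enough for
    \<open>(1 + x) ^ card P\<close> to be negligible, while \<open>Q / x\<close> stays polynomial in
    \<open>n\<close>.\<close>
  define \<beta> where "\<beta> = \<epsilon> * real s / (16 * (1 + \<epsilon>) * N)"
  have \<beta>: "\<beta> > 0" using \<epsilon> s N by (simp add: \<beta>_def)
  define k where "k = nat \<lceil>ln (real n + 1) / \<beta>\<rceil>"
  define Q where "Q = real (n + 2) ^ (2 * r)"
  define x where "x = 1 / real (n + 2) ^ 2"
  have finP: "finite P" unfolding P_def by (auto intro: finite_subset[of _ "Pow {1..n}"])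
  have two: "2 ^ n \<le> (real n + 1) * N"
    unfolding N_def by (rule two_power_le_central_binomial)
  have "card P \<le> card (Pow {1..n})" unfolding P_def by (intro card_mono) auto
  then have cardP_nat: "card P \<le> 2 ^ n" by (simp add: card_Pow)
  then have "real (card P) \<le> real (2 ^ n)" by (simp only: of_nat_le_iff)
  then have cardP: "real (card P) \<le> 2 ^ n" by simp
  have step: "\<exists>v\<in>A. \<exists>W. W \<subseteq> A - {v} \<and> \<beta> * real (card A) \<le> real (card W) \<and>
        real (card ((\<lambda>F. F \<inter> W) ` {F \<in> Collect (up_free r). v \<in> F})) \<le> Q"
    if A: "A \<subseteq> P" and big: "(1 + \<epsilon>) * N < real (card A)" for A
  proof -
    obtain a l where a: "a \<in> A" and l: "\<beta> * real (card A) \<le> real (card {b \<in> A. a \<subset> b \<and> card b = l})"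
      using obtain_dense_level[OF \<epsilon> s(1) A[unfolded P_def] big[unfolded N_def]]
      unfolding \<beta>_def N_def by blast
    \<comment> \<open>The level is cut down to the least admissible size, so that \<open>W\<close>
      has at most \<open>n * (n + 1)\<close> elements and its traces are polynomially many.\<close>
    have "nat \<lceil>\<beta> * real (card A)\<rceil> \<le> card {b \<in> A. a \<subset> b \<and> card b = l}"
      using l by (simp add: nat_le_iff ceiling_le_iff)
    then obtain W where W: "W \<subseteq> {b \<in> A. a \<subset> b \<and> card b = l}" "card W = nat \<lceil>\<beta> * real (card A)\<rceil>"
      "finite W"
      by (rule obtain_subset_with_card_n)
    have "real (card A) \<le> 2 ^ n"
      using card_mono[OF finP A] cardP by linarith
    then have "real (card A) \<le> (real n + 1) * N" using two by linarith
    then have "\<beta> * real (card A) \<le> \<beta> * ((real n + 1) * N)"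
      by (rule mult_left_mono) (use \<beta> in simp)
    also have "\<dots> = \<epsilon> / (1 + \<epsilon>) * (real s / 16 * (real n + 1))"
      using N by (simp add: \<beta>_def)
    also have "\<dots> \<le> 1 * (real s / 16 * (real n + 1))"
      using \<epsilon> by (intro mult_right_mono) auto
    also have "\<dots> \<le> real n * (real n + 1)"
      using s by (simp add: mult_right_mono)
    also have "\<dots> = real (n * (n + 1))" by (simp add: algebra_simps)
    finally have "nat \<lceil>\<beta> * real (card A)\<rceil> \<le> n * (n + 1)"
      by (simp only: nat_le_iff ceiling_le_iff of_int_of_nat_eq)
    then have "card W + 1 \<le> (n + 2) ^ 2"
      using W(2) by (simp add: power2_eq_square)
    have "(\<lambda>F. F \<inter> W) ` {F \<in> Collect (up_free r). a \<in> F} \<subseteq> {T. T \<subseteq> W \<and> card T \<le> r}"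
    proof (rule image_subsetI)
      fix F assume F: "F \<in> {F \<in> Collect (up_free r). a \<in> F}"
      have "card (F \<inter> W) < r"
      proof (rule up_free_card_level)
        show "up_free r F" "a \<in> F" using F by auto
        show "a \<subset> b \<and> finite b \<and> card b = l" if "b \<in> W" for b
          using that W(1) A finite_subset[of b "{1..n}"] by (auto simp: P_def)
      qed
      then show "F \<inter> W \<in> {T. T \<subseteq> W \<and> card T \<le> r}" by auto
    qed
    then have "card ((\<lambda>F. F \<inter> W) ` {F \<in> Collect (up_free r). a \<in> F}) \<le> card {T. T \<subseteq> W \<and> card T \<le> r}"
      using W(3) by (intro card_mono) (auto intro: finite_subset[of _ "Pow W"])
    also have "\<dots> \<le> (card W + 1) ^ r" using W(3) by (rule card_bounded_subsets_le)
    also have "\<dots> \<le> ((n + 2) ^ 2) ^ r" using \<open>card W + 1 \<le> (n + 2) ^ 2\<close> by (intro power_mono) auto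
    also have "\<dots> = (n + 2) ^ (2 * r)" by (simp only: power_mult)
    finally have "real (card ((\<lambda>F. F \<inter> W) ` {F \<in> Collect (up_free r). a \<in> F})) \<le> Q"
      unfolding Q_def of_nat_power[symmetric] of_nat_le_iff .
    moreover have "W \<subseteq> A - {a}" using W(1) by auto
    moreover have "\<beta> * real (card A) \<le> real (card W)"
      unfolding W(2) by (rule real_nat_ceiling_ge)
    ultimately show ?thesis using a by blast
  qed
  have x: "0 < x" "x \<le> Q"
  proof -
    show "0 < x" by (simp add: x_def)
    have "1 \<le> real (n + 2) ^ 2" by (intro one_le_power) simp
    moreover from this have "0 < real (n + 2) ^ 2" by linarith
    ultimately have "x \<le> 1" unfolding x_def by (simp only: divide_le_eq_1_pos)
    also have "1 \<le> Q" unfolding Q_def by (intro one_le_power) simp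
    finally show "x \<le> Q" .
  qed
  have "real (card P) \<le> (real n + 1) * N" using cardP two by linarith
  also have "\<dots> \<le> (1 + \<epsilon>) * N * exp (\<beta> * real k)"
  proof -
    have "ln (real n + 1) / \<beta> \<le> real k" unfolding k_def by (rule real_nat_ceiling_ge)
    then have "ln (real n + 1) \<le> \<beta> * real k" using \<beta> by (simp add: field_simps)
    then have "exp (ln (real n + 1)) \<le> exp (\<beta> * real k)" by (simp only: exp_le_cancel_iff)
    then have "real n + 1 \<le> exp (\<beta> * real k)" by simp
    moreover have "N \<le> (1 + \<epsilon>) * N" using \<epsilon> N by simp
    ultimately have "N * (real n + 1) \<le> (1 + \<epsilon>) * N * exp (\<beta> * real k)"
      using N \<epsilon> by (intro mult_mono) auto
    then show ?thesis by (simp add: mult.commute)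
  qed
  finally have cardP_exp: "real (card P) \<le> (1 + \<epsilon>) * N * exp (\<beta> * real k)" .
  have "real (card {F \<in> Collect (up_free r). F \<subseteq> P})
      \<le> 2 powr ((1 + \<epsilon>) * N) * (Q / x) ^ k * (1 + x) ^ card P"
    by (rule card_hereditary_le[where P = P and \<beta> = \<beta>, OF finP _ step x _ _ cardP_exp])
       (use up_free_subset N \<epsilon> in auto)
  also have "\<dots> \<le> 2 powr ((1 + \<epsilon>) * N) *
      real (n + 2) powr (real (2 * r + 2) * (ln (real n + 1) * (16 * (1 + \<epsilon>) / \<epsilon> * (N / real s)) + 1)) *
      exp (N / (real n + 2))"
  proof (intro mult_mono mult_left_mono)
    have Qx: "Q / x = real (n + 2) ^ (2 * r + 2)"
      by (simp only: Q_def x_def power_add divide_divide_eq_right div_by_1)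
    have "(Q / x) ^ k = real (n + 2) powr real ((2 * r + 2) * k)"
      unfolding Qx power_mult[symmetric] by (rule powr_realpow[symmetric]) simp
    also have "\<dots> = real (n + 2) powr (real (2 * r + 2) * real k)" by (simp only: of_nat_mult)
    also have "\<dots> \<le> real (n + 2) powr (real (2 * r + 2) * (ln (real n + 1) / \<beta> + 1))"
    proof (intro powr_mono mult_left_mono)
      have "0 \<le> ln (real n + 1) / \<beta>" using \<beta> by simp
      then show "real k \<le> ln (real n + 1) / \<beta> + 1" unfolding k_def by linarith
    qed auto
    also have "ln (real n + 1) / \<beta> = ln (real n + 1) * (16 * (1 + \<epsilon>) / \<epsilon> * (N / real s))"
      using \<epsilon> s N by (simp add: \<beta>_def field_simps)
    finally show "(Q / x) ^ k \<le> real (n + 2) powr (real (2 * r + 2) *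
        (ln (real n + 1) * (16 * (1 + \<epsilon>) / \<epsilon> * (N / real s)) + 1))" .
    have "(1 + x) ^ card P \<le> exp x ^ card P"
      using x by (intro power_mono) auto
    also have "\<dots> = exp (x * real (card P))" by (simp add: exp_of_nat2_mult)
    also have "\<dots> \<le> exp (N / (real n + 2))"
    proof -
      have "x * real (card P) \<le> x * ((real n + 1) * N)"
        by (rule mult_left_mono) (use x cardP two in linarith)+
      also have "\<dots> \<le> x * ((real n + 2) * N)"
        using x N by (intro mult_left_mono mult_right_mono) auto
      also have "\<dots> = N / (real n + 2)"
        unfolding x_def of_nat_add of_nat_numeral power2_eq_square by simp
      finally show ?thesis by simp
    qed
    finally show "(1 + x) ^ card P \<le> exp (N / (real n + 2))" .
  qed (use x in auto)
  finally show ?thesis by simp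
qed

text \<open>Sets with complement smaller than \<open>s\<close> number at most
  \<open>(n + 1) ^ s\<close>. The trace of a family on them is arbitrary, which costs the last
  factor.\<close>

lemma card_up_free_le:
  fixes \<epsilon> :: real and n r s :: nat
  defines "N \<equiv> real (n choose (n div 2))"
  assumes \<epsilon>: "\<epsilon> > 0" and s: "1 \<le> s" "s \<le> n"
  shows "real (card {F. F \<subseteq> Pow {1..n} \<and> up_free r F}) \<le>
    2 powr ((1 + \<epsilon>) * N) *
    real (n + 2) powr (real (2 * r + 2) * (ln (real n + 1) * (16 * (1 + \<epsilon>) / \<epsilon> * (N / real s)) + 1)) *
    exp (N / (real n + 2)) * 2 powr (real (n + 1) ^ s)"
proof -
  define P where "P = {a. a \<subseteq> {1..n} \<and> card a + s \<le> n}"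
  define R where "R = Pow {1..n} - P"
  have finP: "finite P" unfolding P_def by (auto intro: finite_subset[of _ "Pow {1..n}"])
  have finR: "finite R" unfolding R_def by simp
  have "R \<subseteq> (\<lambda>T. {1..n} - T) ` {T. T \<subseteq> {1..n} \<and> card T \<le> s}"
  proof
    fix a assume a: "a \<in> R"
    then have sub: "a \<subseteq> {1..n}" "\<not> card a + s \<le> n" by (auto simp: R_def P_def)
    have "finite a" using sub finite_subset by blast
    then have "card ({1..n} - a) = n - card a" using sub by (simp add: card_Diff_subset)
    then have "{1..n} - a \<in> {T. T \<subseteq> {1..n} \<and> card T \<le> s}" using sub by auto
    moreover have "a = {1..n} - ({1..n} - a)" using sub by auto
    ultimately show "a \<in> (\<lambda>T. {1..n} - T) ` {T. T \<subseteq> {1..n} \<and> card T \<le> s}" by blast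
  qed
  moreover have finT: "finite {T. T \<subseteq> {1..n} \<and> card T \<le> s}"
    by (auto intro: finite_subset[of _ "Pow {1..n}"])
  ultimately have "card R \<le> card {T. T \<subseteq> {1..n} \<and> card T \<le> s}"
    by (meson card_image_le card_mono finite_imageI order_trans)
  also have "\<dots> \<le> (n + 1) ^ s" using card_bounded_subsets_le[of "{1..n}" s] by simp
  finally have cardR: "card R \<le> (n + 1) ^ s" .
  let ?L = "{F. up_free r F \<and> F \<subseteq> P}"
  have finL: "finite ?L" using finP by (auto intro: finite_subset[of _ "Pow P"])
  have "{F. F \<subseteq> Pow {1..n} \<and> up_free r F} \<subseteq> (\<lambda>(F, G). F \<union> G) ` (?L \<times> Pow R)"
  proof
    fix F assume F: "F \<in> {F. F \<subseteq> Pow {1..n} \<and> up_free r F}"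
    have "F \<inter> P \<in> ?L" using F up_free_subset[of r F "F \<inter> P"] by auto
    moreover have "F \<inter> R \<in> Pow R" by auto
    moreover have "F = (\<lambda>(F, G). F \<union> G) (F \<inter> P, F \<inter> R)" using F by (auto simp: R_def)
    ultimately show "F \<in> (\<lambda>(F, G). F \<union> G) ` (?L \<times> Pow R)" by blast
  qed
  then have "card {F. F \<subseteq> Pow {1..n} \<and> up_free r F} \<le> card ((\<lambda>(F, G). F \<union> G) ` (?L \<times> Pow R))"
    using finL finR by (intro card_mono) auto
  also have "\<dots> \<le> card (?L \<times> Pow R)"
    using finL finR by (intro card_image_le) auto
  also have "\<dots> = card ?L * 2 ^ card R" using finR by (simp add: card_cartesian_product card_Pow)
  finally have "real (card {F. F \<subseteq> Pow {1..n} \<and> up_free r F}) \<le> real (card ?L * 2 ^ card R)"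
    by (simp only: of_nat_le_iff)
  also have "\<dots> = real (card ?L) * 2 powr real (card R)" by (simp add: powr_realpow)
  also have "\<dots> \<le> (2 powr ((1 + \<epsilon>) * N) *
    real (n + 2) powr (real (2 * r + 2) * (ln (real n + 1) * (16 * (1 + \<epsilon>) / \<epsilon> * (N / real s)) + 1)) *
    exp (N / (real n + 2))) * 2 powr (real (n + 1) ^ s)"
  proof (intro mult_mono)
    show "real (card ?L) \<le> 2 powr ((1 + \<epsilon>) * N) *
      real (n + 2) powr (real (2 * r + 2) * (ln (real n + 1) * (16 * (1 + \<epsilon>) / \<epsilon> * (N / real s)) + 1)) *
      exp (N / (real n + 2))"
      unfolding N_def P_def by (rule card_up_free_lower_le[OF \<epsilon> s])
    have "real (card R) \<le> real (n + 1) ^ s"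
      using cardR by (simp only: of_nat_power[symmetric] of_nat_le_iff)
    then show "2 powr real (card R) \<le> 2 powr (real (n + 1) ^ s)" by simp
  qed auto
  finally show ?thesis .
qed

section \<open>The error terms are negligible\<close>

text \<open>This is the exponent beyond \<open>(1 + \<epsilon>) * N\<close>, divided by
  \<open>N\<close>, for \<open>s\<close> the integer part of \<open>sqrt n\<close>: \<open>s\<close>
  is bounded by \<open>sqrt n - 1\<close> from below and \<open>sqrt n\<close> from above, and
  \<open>1 / N\<close> by \<open>(n + 1) / 2 ^ n\<close>.\<close>

lemma tendsto_exponent_error:
  fixes c d :: real
  shows "(\<lambda>n. d * log 2 (real n + 2) * (ln (real n + 1) * (c / (sqrt (real n) - 1)) + (real n + 1) / 2 ^ n)
    + 1 / ln 2 / (real n + 2) + (real n + 1) powr sqrt (real n) * ((real n + 1) / 2 ^ n)) \<longlonglongrightarrow> 0"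
proof -
  have 1: "(\<lambda>n. ln (real n + 2) * ln (real n + 1) / (sqrt (real n) - 1)) \<longlonglongrightarrow> 0"
    by real_asymp
  have 2: "(\<lambda>n. ln (real n + 2) * ((real n + 1) / 2 ^ n)) \<longlonglongrightarrow> 0"
    by real_asymp
  have 3: "(\<lambda>n. 1 / ln 2 / (real n + 2)) \<longlonglongrightarrow> 0"
    by real_asymp
  have 4: "(\<lambda>n. (real n + 1) powr sqrt (real n) * ((real n + 1) / 2 ^ n)) \<longlonglongrightarrow> 0"
    by real_asymp
  have "(\<lambda>n. (d * c / ln 2) * (ln (real n + 2) * ln (real n + 1) / (sqrt (real n) - 1))
      + (d / ln 2) * (ln (real n + 2) * ((real n + 1) / 2 ^ n))
      + 1 / ln 2 / (real n + 2)
      + (real n + 1) powr sqrt (real n) * ((real n + 1) / 2 ^ n)) \<longlonglongrightarrow> 0"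
    by (intro tendsto_add_zero tendsto_mult_right_zero 1 2 3 4)
  then show ?thesis
    by (simp add: log_def algebra_simps add_divide_distrib)
qed

lemma eventually_card_up_free_le:
  fixes \<delta> :: real
  assumes \<delta>: "\<delta> > 0"
  shows "\<forall>\<^sub>F n in sequentially. real (card {F. F \<subseteq> Pow {1..n} \<and> up_free r F})
    \<le> 2 powr ((1 + \<delta>) * real (n choose (n div 2)))"
proof -
  \<comment> \<open>One half of \<open>\<delta>\<close> goes to the main term, the other to the
    error \<open>E n\<close>.\<close>
  define \<epsilon> where "\<epsilon> = \<delta> / 2"
  have \<epsilon>: "\<epsilon> > 0" using \<delta> by (simp add: \<epsilon>_def)
  define c where "c = 16 * (1 + \<epsilon>) / \<epsilon>"
  define d where "d = real (2 * r + 2)"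
  define E where "E = (\<lambda>n. d * log 2 (real n + 2) * (ln (real n + 1) * (c / (sqrt (real n) - 1)) + (real n + 1) / 2 ^ n)
    + 1 / ln 2 / (real n + 2) + (real n + 1) powr sqrt (real n) * ((real n + 1) / 2 ^ n))"
  have "\<forall>\<^sub>F n in sequentially. E n < \<epsilon>"
    using tendsto_exponent_error[of d c] \<epsilon> unfolding E_def by (rule order_tendstoD)
  moreover have "\<forall>\<^sub>F n in sequentially. n \<ge> 4" by (rule eventually_ge_at_top)
  ultimately show ?thesis
  proof eventually_elim
    case (elim n)
    define N where "N = real (n choose (n div 2))"
    have N: "N > 0" using central_binomial_pos by (simp add: N_def)
    have two: "2 ^ n \<le> (real n + 1) * N"
      unfolding N_def by (rule two_power_le_central_binomial)
    \<comment> \<open>Used to turn terms without a factor \<open>N\<close> into multiples of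
      \<open>N\<close>.\<close>
    then have invN: "1 \<le> N * ((real n + 1) / 2 ^ n)" by (simp add: field_simps)
    \<comment> \<open>Large enough to beat the squared logarithm in the cost of branching, small
      enough that \<open>(n + 1) ^ s\<close> is of smaller order than
      \<open>2 ^ n / (n + 1)\<close>.\<close>
    define s where "s = nat \<lfloor>sqrt (real n)\<rfloor>"
    have sq: "sqrt (real n) \<ge> 2" using elim(2) by (intro real_le_rsqrt) simp
    then have s_lower: "sqrt (real n) - 1 < real s" and s_upper: "real s \<le> sqrt (real n)"
      unfolding s_def by linarith+
    have "sqrt (real n) \<le> real n"
      using elim(2) by (intro real_le_lsqrt) (auto simp: power2_eq_square)
    then have s: "1 \<le> s" "s \<le> n" using s_upper s_lower sq by linarith+
    have c: "c \<ge> 0" "d \<ge> 0" using \<epsilon> by (auto simp: c_def d_def)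
    have pos: "0 < real s" "0 < sqrt (real n) - 1" using s_lower sq by linarith+
    have "N / real s \<le> N / (sqrt (real n) - 1)"
      by (rule divide_left_mono[OF less_imp_le[OF s_lower] less_imp_le[OF N] mult_pos_pos[OF pos]])
    then have "ln (real n + 1) * (c * (N / real s)) + 1
        \<le> ln (real n + 1) * (c * (N / (sqrt (real n) - 1))) + N * ((real n + 1) / 2 ^ n)"
      using c invN by (intro add_mono mult_left_mono) auto
    also have "\<dots> = N * (ln (real n + 1) * (c / (sqrt (real n) - 1)) + (real n + 1) / 2 ^ n)"
      by (simp add: algebra_simps)
    finally have "real (n + 2) powr (d * (ln (real n + 1) * (c * (N / real s)) + 1))
        \<le> real (n + 2) powr (d * (N * (ln (real n + 1) * (c / (sqrt (real n) - 1)) + (real n + 1) / 2 ^ n)))"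
      using c by (intro powr_mono mult_left_mono) auto
    also have "\<dots> = (2 powr log 2 (real n + 2)) powr (d * (N * (ln (real n + 1) * (c / (sqrt (real n) - 1)) + (real n + 1) / 2 ^ n)))"
      by (simp add: add.commute)
    also have "\<dots> = 2 powr (N * (d * log 2 (real n + 2) * (ln (real n + 1) * (c / (sqrt (real n) - 1)) + (real n + 1) / 2 ^ n)))"
      unfolding powr_powr by (simp only: mult_ac)
    finally have t2: "real (n + 2) powr (d * (ln (real n + 1) * (c * (N / real s)) + 1))
      \<le> 2 powr (N * (d * log 2 (real n + 2) * (ln (real n + 1) * (c / (sqrt (real n) - 1)) + (real n + 1) / 2 ^ n)))" .
    have t3: "exp (N / (real n + 2)) \<le> 2 powr (N * (1 / ln 2 / (real n + 2)))"
      by (simp add: powr_def)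
    have "real (n + 1) ^ s = (real n + 1) powr real s" by (simp add: powr_realpow add.commute)
    also have "\<dots> \<le> (real n + 1) powr sqrt (real n)" using s_upper by (intro powr_mono) auto
    also have "\<dots> \<le> (real n + 1) powr sqrt (real n) * (N * ((real n + 1) / 2 ^ n))"
      using invN by (intro mult_le_cancel_left1[THEN iffD2]) auto
    finally have "real (n + 1) ^ s \<le> N * ((real n + 1) powr sqrt (real n) * ((real n + 1) / 2 ^ n))"
      by (simp add: mult_ac)
    then have t4: "2 powr (real (n + 1) ^ s) \<le> 2 powr (N * ((real n + 1) powr sqrt (real n) * ((real n + 1) / 2 ^ n)))"
      by simp
    have "real (card {F. F \<subseteq> Pow {1..n} \<and> up_free r F}) \<le>
      2 powr ((1 + \<epsilon>) * N) * real (n + 2) powr (d * (ln (real n + 1) * (c * (N / real s)) + 1)) *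
      exp (N / (real n + 2)) * 2 powr (real (n + 1) ^ s)"
      unfolding N_def c_def d_def by (rule card_up_free_le[OF \<epsilon> s])
    also have "\<dots> \<le> 2 powr ((1 + \<epsilon>) * N) *
      2 powr (N * (d * log 2 (real n + 2) * (ln (real n + 1) * (c / (sqrt (real n) - 1)) + (real n + 1) / 2 ^ n))) *
      2 powr (N * (1 / ln 2 / (real n + 2))) *
      2 powr (N * ((real n + 1) powr sqrt (real n) * ((real n + 1) / 2 ^ n)))"
      by (intro mult_mono t2 t3 t4 order_refl) auto
    also have "\<dots> = 2 powr ((1 + \<epsilon>) * N + N * E n)"
      unfolding E_def by (simp only: powr_add[symmetric] ring_distribs add.assoc)
    also have "\<dots> \<le> 2 powr ((1 + \<delta>) * N)"
    proof -
      have "N * E n \<le> N * \<epsilon>" using elim(1) N by simp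
      then have "(1 + \<epsilon>) * N + N * E n \<le> (1 + \<delta>) * N" by (simp add: \<epsilon>_def algebra_simps)
      then show ?thesis by simp
    qed
    finally show ?case unfolding N_def .
  qed
qed

section \<open>The asymptotics\<close>

lemma two_power_central_binomial_asympI:
  assumes upper: "\<And>\<delta>. \<delta> > 0 \<Longrightarrow> \<forall>\<^sub>F n in sequentially. real (f n) \<le> 2 powr ((c + \<delta>) * real (n choose (n div 2)))"
    and lower: "\<And>\<delta>. \<delta> > 0 \<Longrightarrow> \<forall>\<^sub>F n in sequentially. 2 powr ((c - \<delta>) * real (n choose (n div 2))) \<le> real (f n)"
  shows "two_power_central_binomial_asymp c f"
  unfolding two_power_central_binomial_asymp_def
proof (intro exI conjI)
  let ?N = "\<lambda>n. real (n choose (n div 2))"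
  have N: "?N n > 0" for n using central_binomial_pos by simp
  \<comment> \<open>The value forced by solving the required equation; it works once
    \<open>f n > 0\<close>, which the lower bound provides for large \<open>n\<close>.\<close>
  define \<epsilon> where "\<epsilon> = (\<lambda>n. log 2 (real (f n)) / ?N n - c)"
  have powr_\<epsilon>: "real (f n) = 2 powr ((c + \<epsilon> n) * ?N n)" if "real (f n) > 0" for n
  proof -
    have "(c + \<epsilon> n) * ?N n = log 2 (real (f n))" using N[of n] by (simp add: \<epsilon>_def)
    then show ?thesis using that by simp
  qed
  have pos: "\<forall>\<^sub>F n in sequentially. real (f n) > 0"
    using lower[of 1, OF zero_less_one]
  proof eventually_elim
    case (elim n)
    have "0 < 2 powr ((c - 1) * ?N n)" by simp
    then show ?case using elim by linarith
  qed
  show "\<forall>\<^sub>F n in sequentially. real (f n) = 2 powr ((c + \<epsilon> n) * ?N n)"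
    using pos by eventually_elim (rule powr_\<epsilon>)
  show "\<epsilon> \<longlonglongrightarrow> 0"
  proof (rule tendstoI)
    fix e :: real assume "e > 0"
    then have e: "e / 2 > 0" by simp
    show "\<forall>\<^sub>F n in sequentially. dist (\<epsilon> n) 0 < e"
      using upper[OF e] lower[OF e] pos
    proof eventually_elim
      case (elim n)
      have "2 powr ((c + \<epsilon> n) * ?N n) \<le> 2 powr ((c + e / 2) * ?N n)"
        using elim(1) powr_\<epsilon>[OF elim(3)] by simp
      then have u: "\<epsilon> n \<le> e / 2" using N[of n] by simp
      have "2 powr ((c - e / 2) * ?N n) \<le> 2 powr ((c + \<epsilon> n) * ?N n)"
        using elim(2) powr_\<epsilon>[OF elim(3)] by simp
      then have "c - e / 2 \<le> c + \<epsilon> n" using N[of n] by simp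
      then show ?case using u \<open>e > 0\<close> by (simp add: dist_real_def)
    qed
  qed
qed

text \<open>Source of both lower bounds: levels of distinct sizes are disjoint, and every subfamily
  of their union belongs to \<open>X\<close>.\<close>

lemma card_subsets_of_levels:
  assumes "\<And>F. F \<subseteq> {a. a \<subseteq> {1..n} \<and> card a \<in> K} \<Longrightarrow> F \<in> X" "finite X" "finite K"
  shows "2 ^ (\<Sum>k\<in>K. n choose k) \<le> card X"
proof -
  let ?L = "\<lambda>k. {a. a \<subseteq> {1..n} \<and> card a = k}"
  have fin: "finite (?L k)" for k by (auto intro: finite_subset[of _ "Pow {1..n}"])
  have "{a. a \<subseteq> {1..n} \<and> card a \<in> K} = (\<Union>k\<in>K. ?L k)" by auto
  moreover have "card (\<Union>k\<in>K. ?L k) = (\<Sum>k\<in>K. card (?L k))"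
    using assms(3) fin by (intro card_UN_disjoint) auto
  ultimately have "card {a. a \<subseteq> {1..n} \<and> card a \<in> K} = (\<Sum>k\<in>K. n choose k)"
    by (simp add: n_subsets)
  moreover have "finite {a. a \<subseteq> {1..n} \<and> card a \<in> K}" by (auto intro: finite_subset[of _ "Pow {1..n}"])
  ultimately have "2 ^ (\<Sum>k\<in>K. n choose k) = card (Pow {a. a \<subseteq> {1..n} \<and> card a \<in> K})"
    by (simp add: card_Pow)
  also have "\<dots> \<le> card X" using assms by (intro card_mono) auto
  finally show ?thesis .
qed

section \<open>Families without induced fans\<close>

lemma induced_free_families_vee:
  assumes "r \<ge> 1"
  shows "induced_free_families (vee_carrier r) (vee_order r) n = {F. F \<subseteq> Pow {1..n} \<and> up_free r F}"
  by (simp only: induced_free_families_def induced_free_vee_iff[OF assms])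

lemma vee_asymp:
  assumes r: "r \<ge> 1"
  shows "two_power_central_binomial_asymp 1 (\<lambda>n. card (induced_free_families (vee_carrier r) (vee_order r) n))"
proof (rule two_power_central_binomial_asympI)
  fix \<delta> :: real assume \<delta>: "\<delta> > 0"
  show "\<forall>\<^sub>F n in sequentially. real (card (induced_free_families (vee_carrier r) (vee_order r) n))
      \<le> 2 powr ((1 + \<delta>) * real (n choose (n div 2)))"
    unfolding induced_free_families_vee[OF r] by (rule eventually_card_up_free_le[OF \<delta>])
  have "2 powr ((1 - \<delta>) * real (n choose (n div 2)))
      \<le> real (card (induced_free_families (vee_carrier r) (vee_order r) n))" for n
  proof -
    have "2 ^ (\<Sum>k\<in>{n div 2}. n choose k) \<le> card (induced_free_families (vee_carrier r) (vee_order r) n)"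
    proof (rule card_subsets_of_levels)
      fix F assume F: "F \<subseteq> {a. a \<subseteq> {1..n} \<and> card a \<in> {n div 2}}"
      have "\<not> a \<subset> b" if "a \<in> F" "b \<in> F" for a b
      proof
        assume "a \<subset> b"
        moreover have "finite b" using F that finite_subset by blast
        ultimately have "card a < card b" by (rule psubset_card_mono[rotated])
        moreover have "card a = n div 2" "card b = n div 2" using F that by auto
        ultimately show False by simp
      qed
      then have "up_free r F" using r by (intro up_free_antichain) auto
      then show "F \<in> induced_free_families (vee_carrier r) (vee_order r) n"
        unfolding induced_free_families_vee[OF r] using F by auto
    qed (auto simp: finite_induced_free_families)
    then have "real (2 ^ (n choose (n div 2))) \<le> real (card (induced_free_families (vee_carrier r) (vee_order r) n))"
      by (simp only: of_nat_le_iff sum.insert sum.empty finite.emptyI empty_iff not_False_eq_True add_0_right)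
    then have "2 powr real (n choose (n div 2)) \<le> real (card (induced_free_families (vee_carrier r) (vee_order r) n))"
      by (simp add: powr_realpow)
    moreover have "(1 - \<delta>) * real (n choose (n div 2)) \<le> 1 * real (n choose (n div 2))"
      using \<delta> by (intro mult_right_mono) auto
    then have "2 powr ((1 - \<delta>) * real (n choose (n div 2))) \<le> 2 powr real (n choose (n div 2))" by simp
    ultimately show ?thesis by linarith
  qed
  then show "\<forall>\<^sub>F n in sequentially. 2 powr ((1 - \<delta>) * real (n choose (n div 2)))
      \<le> real (card (induced_free_families (vee_carrier r) (vee_order r) n))"
    by simp
qed

section \<open>Families without induced \<open>K_{s,1,t}\<close>\<close>

text \<open>Complementation reverses inclusion, so an inverted fan becomes a fan and the count for
  \<open>up_free\<close> applies to both pieces.\<close>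

lemma induced_free_K_split:
  assumes F: "induced_free (K_carrier s t) (K_order s t) F" "F \<subseteq> Pow S" and st: "s \<ge> 1" "t \<ge> 1"
  shows "\<exists>G H. F = G \<union> (\<lambda>a. S - a) ` H \<and> G \<subseteq> Pow S \<and> up_free t G \<and> H \<subseteq> Pow S \<and> up_free s H"
proof -
  define G where "G = {b \<in> F. \<not> (\<exists>C\<subseteq>F. card C = t \<and> (\<forall>c\<in>C. b \<subset> c) \<and> (\<forall>x\<in>C. \<forall>y\<in>C. x \<subseteq> y \<longrightarrow> x = y))}"
  define H where "H = (\<lambda>a. S - a) ` (F - G)"
  have compl: "S - (S - a) = a" if "a \<in> F" for a using that F(2) by auto
  have "(\<lambda>a. S - a) ` H = F - G"
    unfolding H_def image_image using compl by force
  then have "F = G \<union> (\<lambda>a. S - a) ` H" by (auto simp: G_def)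
  moreover have "G \<subseteq> Pow S" "H \<subseteq> Pow S" using F(2) by (auto simp: G_def H_def)
  moreover have "up_free t G"
  proof (rule ccontr)
    assume "\<not> up_free t G"
    then obtain b C where b: "b \<in> G" and C: "C \<subseteq> G" "card C = t" "\<forall>c\<in>C. b \<subset> c"
      "\<forall>x\<in>C. \<forall>y\<in>C. x \<subseteq> y \<longrightarrow> x = y"
      unfolding up_free_def by blast
    \<comment> \<open>A fan inside \<open>G\<close> is also a fan inside \<open>F\<close>, contrary
      to the choice of its bottom \<open>b\<close>.\<close>
    have "C \<subseteq> F" using C(1) by (auto simp: G_def)
    then show False using b C(2-4) unfolding G_def by blast
  qed
  moreover have "up_free s H"
  proof (rule ccontr)
    assume "\<not> up_free s H"
    then obtain b' B' where b': "b' \<in> H" and B': "B' \<subseteq> H" "card B' = s" "\<forall>x\<in>B'. b' \<subset> x"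
      "\<forall>x\<in>B'. \<forall>y\<in>B'. x \<subseteq> y \<longrightarrow> x = y"
      unfolding up_free_def by blast
    define b where "b = S - b'"
    define B where "B = (\<lambda>a. S - a) ` B'"
    have HS: "x \<subseteq> S" "S - x \<in> F - G" if "x \<in> H" for x
      using that compl by (auto simp: H_def)
    \<comment> \<open>Not lying in \<open>G\<close>, \<open>b\<close> is the bottom of a fan with
      prongs \<open>C\<close>. The complements of \<open>B'\<close> lie below it, so
      \<open>b\<close> becomes the middle element of the forbidden poset.\<close>
    have bF: "b \<in> F" "b \<notin> G" using HS(2)[OF b'] by (auto simp: b_def)
    then obtain C where C: "C \<subseteq> F" "card C = t" "\<forall>c\<in>C. b \<subset> c"
      "\<forall>x\<in>C. \<forall>y\<in>C. x \<subseteq> y \<longrightarrow> x = y"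
      unfolding G_def by blast
    have inj: "inj_on (\<lambda>a. S - a) B'"
      using B'(1) HS(1) by (intro inj_onI) (metis double_diff order_refl subsetD)
    have "\<not> induced_free (K_carrier s t) (K_order s t) F"
    proof (rule not_induced_free_KI[OF bF(1) _ C(1) _ C(2) st])
      show "B \<subseteq> F" using B'(1) HS(2) by (auto simp: B_def)
      show "card B = s" unfolding B_def using card_image[OF inj] B'(2) by simp
      show "x \<subset> b" if xB: "x \<in> B" for x
      proof -
        obtain y where y: "y \<in> B'" "x = S - y" using xB by (auto simp: B_def)
        have "y \<subseteq> S" "b' \<subset> y" using y(1) B'(1,3) HS(1) by auto
        then show ?thesis unfolding y(2) b_def by blast
      qed
      show "b \<subset> x" if "x \<in> C" for x using that C(3) by simp
      show "x = y" if xy: "x \<in> B" "y \<in> B" "x \<subseteq> y" for x y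
      proof -
        obtain u v where u: "u \<in> B'" "x = S - u" and v: "v \<in> B'" "y = S - v"
          using xy by (auto simp: B_def)
        have "u \<subseteq> S" "v \<subseteq> S" using u v B'(1) HS(1) by auto
        then have "v \<subseteq> u" using xy(3) u(2) v(2) by blast
        then have "v = u" using B'(4) u(1) v(1) by blast
        then show ?thesis using u(2) v(2) by simp
      qed
      show "x = y" if "x \<in> C" "y \<in> C" "x \<subseteq> y" for x y using that C(4) by blast
    qed
    then show False using F(1) by simp
  qed
  ultimately show ?thesis by (intro exI[of _ G] exI[of _ H] conjI)
qed

lemma card_induced_free_families_K_le:
  assumes "s \<ge> 1" "t \<ge> 1"
  shows "card (induced_free_families (K_carrier s t) (K_order s t) n)
    \<le> card {F. F \<subseteq> Pow {1..n} \<and> up_free t F} * card {F. F \<subseteq> Pow {1..n} \<and> up_free s F}"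
proof -
  define S where "S = {1..n}"
  let ?X = "{F. F \<subseteq> Pow S \<and> up_free t F} \<times> {F. F \<subseteq> Pow S \<and> up_free s F}"
  define f where "f = (\<lambda>(G, H). G \<union> (\<lambda>a. S - a) ` H)"
  have fin: "finite {F. F \<subseteq> Pow S \<and> up_free q F}" for q
    by (auto intro: finite_subset[of _ "Pow (Pow S)"] simp: S_def)
  have "induced_free_families (K_carrier s t) (K_order s t) n \<subseteq> f ` ?X"
  proof
    fix F assume "F \<in> induced_free_families (K_carrier s t) (K_order s t) n"
    then have "induced_free (K_carrier s t) (K_order s t) F" "F \<subseteq> Pow S"
      by (simp_all add: induced_free_families_def S_def)
    from induced_free_K_split[OF this assms] obtain G H where
      "F = G \<union> (\<lambda>a. S - a) ` H" "G \<subseteq> Pow S" "up_free t G" "H \<subseteq> Pow S" "up_free s H"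
      by (elim exE conjE)
    then have "F = f (G, H)" "(G, H) \<in> ?X" by (simp_all add: f_def)
    then show "F \<in> f ` ?X" by (rule image_eqI)
  qed
  then have "card (induced_free_families (K_carrier s t) (K_order s t) n) \<le> card (f ` ?X)"
    using fin by (intro card_mono) auto
  also have "\<dots> \<le> card ?X" using fin by (intro card_image_le) auto
  finally show ?thesis by (simp add: card_cartesian_product S_def)
qed

text \<open>With \<open>k = n div 2\<close>, the ratio of consecutive binomials is
  \<open>(n - k) / (k + 1)\<close>, and \<open>2 * k \<le> n\<close> makes it at least
  \<open>n / (n + 2)\<close>. Hence two adjacent middle levels have \<open>(2 + o(1)) * N\<close>
  sets.\<close>

lemma next_to_central_binomial_ge:
  "real n / (real n + 2) * real (n choose (n div 2)) \<le> real (n choose Suc (n div 2))"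
proof -
  define k where "k = n div 2"
  have "Suc k * (n choose Suc k) = (n - k) * (n choose k)"
    by (simp only: binomial_absorption binomial_absorb_comp)
  then have "real (Suc k * (n choose Suc k)) = real ((n - k) * (n choose k))" by simp
  then have eq: "(real k + 1) * real (n choose Suc k) = (real n - real k) * real (n choose k)"
    by (simp add: of_nat_diff k_def algebra_simps)
  have k: "2 * real k \<le> real n" unfolding k_def by linarith
  have "real n * real (n choose k) * (2 * (real k + 1)) = real n * (2 * real k + 2) * real (n choose k)"
    by (simp add: algebra_simps)
  also have "\<dots> \<le> (2 * (real n - real k)) * (real n + 2) * real (n choose k)"
    using k by (intro mult_right_mono mult_mono) auto
  also have "\<dots> = (real n + 2) * real (n choose Suc k) * (2 * (real k + 1))"
  proof -
    have "(2 * (real n - real k)) * (real n + 2) * real (n choose k)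
        = 2 * (real n + 2) * ((real n - real k) * real (n choose k))" by (simp only: mult_ac)
    also have "\<dots> = 2 * (real n + 2) * ((real k + 1) * real (n choose Suc k))" by (simp only: eq)
    also have "\<dots> = (real n + 2) * real (n choose Suc k) * (2 * (real k + 1))" by (simp only: mult_ac)
    finally show ?thesis .
  qed
  finally have "real n * real (n choose k) \<le> (real n + 2) * real (n choose Suc k)"
    by (rule mult_right_le_imp_le) simp
  then show ?thesis unfolding k_def[symmetric] by (simp add: field_simps)
qed

lemma K_asymp:
  assumes st: "s \<ge> 1" "t \<ge> 1"
  shows "two_power_central_binomial_asymp 2 (\<lambda>n. card (induced_free_families (K_carrier s t) (K_order s t) n))"
proof (rule two_power_central_binomial_asympI)
  let ?X = "induced_free_families (K_carrier s t) (K_order s t)"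
  fix \<delta> :: real assume \<delta>: "\<delta> > 0"
  then have \<delta>2: "\<delta> / 2 > 0" by simp
  show "\<forall>\<^sub>F n in sequentially. real (card (?X n)) \<le> 2 powr ((2 + \<delta>) * real (n choose (n div 2)))"
    using eventually_card_up_free_le[OF \<delta>2, of s] eventually_card_up_free_le[OF \<delta>2, of t]
  proof eventually_elim
    case (elim n)
    let ?N = "real (n choose (n div 2))"
    have "real (card (?X n)) \<le> real (card {F. F \<subseteq> Pow {1..n} \<and> up_free t F} * card {F. F \<subseteq> Pow {1..n} \<and> up_free s F})"
      using card_induced_free_families_K_le[OF st] by (simp only: of_nat_le_iff)
    also have "\<dots> \<le> 2 powr ((1 + \<delta> / 2) * ?N) * 2 powr ((1 + \<delta> / 2) * ?N)"
      unfolding of_nat_mult using elim by (intro mult_mono) auto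
    also have "\<dots> = 2 powr ((2 + \<delta>) * ?N)"
      by (simp add: powr_add[symmetric] algebra_simps)
    finally show ?case .
  qed
  have "(\<lambda>n. real n / (real n + 2)) \<longlonglongrightarrow> 1" by real_asymp
  then have "\<forall>\<^sub>F n in sequentially. 1 - \<delta> < real n / (real n + 2)"
    by (rule order_tendstoD) (use \<delta> in simp)
  then show "\<forall>\<^sub>F n in sequentially. 2 powr ((2 - \<delta>) * real (n choose (n div 2))) \<le> real (card (?X n))"
  proof eventually_elim
    case (elim n)
    let ?k = "n div 2"
    let ?N = "real (n choose ?k)"
    \<comment> \<open>Chains within two adjacent levels have at most two sets, so every subfamily of
      these levels is free.\<close>
    have "2 ^ (\<Sum>k\<in>{?k, Suc ?k}. n choose k) \<le> card (?X n)"
    proof (rule card_subsets_of_levels)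
      fix F assume F: "F \<subseteq> {a. a \<subseteq> {1..n} \<and> card a \<in> {?k, Suc ?k}}"
      have less: "card x < card y" if "x \<subset> y" "y \<in> F" for x y
        using that F finite_subset[of y "{1..n}"] by (intro psubset_card_mono) auto
      have "induced_free (K_carrier s t) (K_order s t) F"
      proof (rule induced_free_KI[OF _ st])
        fix x y z assume xyz: "x \<in> F" "y \<in> F" "z \<in> F" "x \<subset> y" "y \<subset> z"
        have "card x < card y" "card y < card z" using less xyz by auto
        moreover have "card x \<in> {?k, Suc ?k}" "card z \<in> {?k, Suc ?k}" using F xyz by auto
        ultimately show False by auto
      qed
      then show "F \<in> ?X n" unfolding induced_free_families_def using F by auto
    qed (auto simp: finite_induced_free_families)
    then have "2 ^ ((n choose ?k) + (n choose Suc ?k)) \<le> card (?X n)" by simp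
    then have "real (2 ^ ((n choose ?k) + (n choose Suc ?k))) \<le> real (card (?X n))"
      by (simp only: of_nat_le_iff)
    moreover have "real (2 ^ ((n choose ?k) + (n choose Suc ?k))) = 2 powr (?N + real (n choose Suc ?k))"
      by (simp add: powr_realpow powr_add power_add)
    moreover have "(2 - \<delta>) * ?N \<le> ?N + real (n choose Suc ?k)"
    proof -
      have "(1 - \<delta>) * ?N \<le> real n / (real n + 2) * ?N" using elim by (intro mult_right_mono) auto
      then show ?thesis using next_to_central_binomial_ge[of n] by (simp add: algebra_simps)
    qed
    then have "2 powr ((2 - \<delta>) * ?N) \<le> 2 powr (?N + real (n choose Suc ?k))" by simp
    ultimately show ?case by linarith
  qed
qed

theorem theorem1p10:
  shows "(\<forall>r::nat. r \<ge> 1 \<longrightarrow>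
            two_power_central_binomial_asymp 1
              (\<lambda>n. card (induced_free_families (vee_carrier r) (vee_order r) n)))
       \<and> (\<forall>s t::nat. s \<ge> 1 \<longrightarrow> t \<ge> 1 \<longrightarrow>
            two_power_central_binomial_asymp 2
              (\<lambda>n. card (induced_free_families (K_carrier s t) (K_order s t) n)))"
  using vee_asymp K_asymp by blast

end
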